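(* A twisted cone $X$ in the space $P^4$ foliates into a one-parameter family of pencils of straight lines whose centers are located on its focal line (curve) $G^1$ and whose planes are tangent to $G^1$.
   Context: All considerations are local. A smooth $n$-dimensional variety $X\subset P^N$ has a degenerate Gauss map of rank $r$ if its Gauss map $x\mapsto T_x(X)$ (tangent projective $n$-plane) has constant rank $r<n$ at regular points. It is foliated by leaves $L$ of dimension $n-r$, along which the tangent space $T_L$ is constant; the leaves are projective subspaces (singular points are included in $L$). Here $X\subset P^4$ is a hypersurface, $n=3$, $r=2$, so the leaves $L$ are straight lines (rectilinear generators), forming a two-parameter family. Moving frames. Take projective frames $\{A_0,\dots,A_4\}$ with $dA_u=\omega_u^vA_v$, $d\omega_u^v=\omega_u^w\wedge\omega_w^v$, where $A_0$ is a regular point of $L$, $A_1\in L$, $A_2,A_3\in T_L$, $A_4\notin T_L$, so that $L=A_0\wedge A_1$. Then $\omega_0^4=\omega_1^4=0$. The forms $\omega_0^2,\omega_0^3$ are the basis forms (linearly independent; they vanish exactly along the leaves), and for $p,q\in\{2,3\}$ $$\omega_p^4=b_{pq}\omega_0^q,\qquad \omega_1^p=c_q^p\omega_0^q,$$ with $B=(b_{pq})$ symmetric and nondegenerate, $C=(c^p_q)$, and $BC$ symmetric. The foci of $L$ are the points $x^0A_0+x^1A_1$ with $\det(\delta^p_qx^0+c^p_qx^1)=0$. We assume that every $L$ has a single focus, which is double; $A_1$ is placed at this focus, so that $C$ is nilpotent, and it is assumed that $C\neq0$. In a suitable frame the equations become $$\omega_2^4=b_{23}\omega_0^3,\quad \omega_3^4=b_{23}\omega_0^2+b_{33}\omega_0^3,\quad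 \omega_1^2=c_3^2\omega_0^3,\quad \omega_1^3=0,\qquad b_{23}\ne0,\ c_3^2\neq0.$$ Twisted cone in $P^4$: a hypersurface $X\subset P^4$ with degenerate Gauss map of rank two, having on each rectilinear generator $L$ a single focus $A_1$, which is double, with $C\neq0$, and whose double focus $A_1$ describes a curve $G^1$ (the focal line; equivalently $\omega_1^0\wedge\omega_0^3=0$), so that $X$ foliates into a one-parameter family of two-dimensional cones (fiber cones), where the fiber cone with vertex $A_1\in G^1$ is the two-dimensional cone swept out by the generators $L$ whose focus is the fixed point $A_1$ (obtained for $\omega_0^3=0$). A pencil of straight lines with center $A$ and plane $\gamma\ni A$ is the family of lines through $A$ lying in the 2-plane $\gamma$ (locally, an open part of it). The plane of a pencil is tangent to $G^1$ if it contains the tangent line of $G^1$ at the center of the pencil. *)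

theory Defs
  imports "HOL-Analysis.Analysis" "HOL-Computational_Algebra.Polynomial"
begin

text \<open>
  The projective space P^4 is modelled by its homogeneous coordinate space real^5: a point is a
  nonzero vector up to scale, and a projective k-plane is a linear subspace of dimension k + 1.
  Maps into P^4 are given by nowhere vanishing lifts to real^5.
\<close>

primrec diff_on :: "nat \<Rightarrow> 'a set \<Rightarrow> ('a::euclidean_space \<Rightarrow> 'b::real_normed_vector) \<Rightarrow> bool" where
  "diff_on 0 S f \<longleftrightarrow> continuous_on S f"
| "diff_on (Suc k) S f \<longleftrightarrow>
     (\<forall>x\<in>S. f differentiable (at x)) \<and> (\<forall>h. diff_on k S (\<lambda>x. frechet_derivative f (at x) h))"

definition smooth_on :: "'a set \<Rightarrow> ('a::euclidean_space \<Rightarrow> 'b::real_normed_vector) \<Rightarrow> bool" where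
  "smooth_on S f \<longleftrightarrow> (\<forall>k. diff_on k S f)"

text \<open>
  For a lift f of a map [f] into projective space, the following subspace is the image of the
  differential of [f], as a projective subspace through the point [f p]. It depends only on [f],
  since replacing f by a scalar multiple adds to its derivatives multiples of f p.
\<close>

definition tangent_space :: "('a::euclidean_space \<Rightarrow> 'b::euclidean_space) \<Rightarrow> 'a \<Rightarrow> 'b set" where
  "tangent_space f p = span (insert (f p) (range (frechet_derivative f (at p))))"

text \<open>The rank of the differential of [f] at p, provided that f p is nonzero.\<close>

definition proj_rank :: "('a::euclidean_space \<Rightarrow> 'b::euclidean_space) \<Rightarrow> 'a \<Rightarrow> nat" where
  "proj_rank f p = dim (tangent_space f p) - 1"

text \<open>
  A hypersurface of P^4 is given, at its regular points, by a lift x of an immersion of an open set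
  of parameters. The lift xi is a lift of the Gauss map into the dual projective space, hyperplanes
  being identified with their normal directions.
\<close>

definition hypersurface :: "(real^3) set \<Rightarrow> (real^3 \<Rightarrow> real^5) \<Rightarrow> bool" where
  "hypersurface \<Omega> x \<longleftrightarrow>
     open \<Omega> \<and> smooth_on \<Omega> x \<and> (\<forall>p\<in>\<Omega>. x p \<noteq> 0 \<and> proj_rank x p = 3)"

definition gauss_lift :: "(real^3) set \<Rightarrow> (real^3 \<Rightarrow> real^5) \<Rightarrow> (real^3 \<Rightarrow> real^5) \<Rightarrow> bool" where
  "gauss_lift \<Omega> x \<xi> \<longleftrightarrow>
     smooth_on \<Omega> \<xi> \<and> (\<forall>p\<in>\<Omega>. \<xi> p \<noteq> 0 \<and> tangent_space x p = {y. \<xi> p \<bullet> y = 0})"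

definition degenerate_gauss_map :: "(real^3) set \<Rightarrow> (real^3 \<Rightarrow> real^5) \<Rightarrow> nat \<Rightarrow> bool" where
  "degenerate_gauss_map \<Omega> x r \<longleftrightarrow>
     hypersurface \<Omega> x \<and> r < 3 \<and> (\<exists>\<xi>. gauss_lift \<Omega> x \<xi> \<and> (\<forall>p\<in>\<Omega>. proj_rank \<xi> p = r))"

text \<open>
  The leaf through p in the parameter domain, and the projective subspace L of which its image is
  an open part. Unlike the image of the leaf, L contains the singular points (the foci).
\<close>

definition leaf :: "(real^3) set \<Rightarrow> (real^3 \<Rightarrow> real^5) \<Rightarrow> real^3 \<Rightarrow> (real^3) set" where
  "leaf \<Omega> x p = connected_component_set {q\<in>\<Omega>. tangent_space x q = tangent_space x p} p"

definition generator :: "(real^3) set \<Rightarrow> (real^3 \<Rightarrow> real^5) \<Rightarrow> real^3 \<Rightarrow> (real^5) set" where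
  "generator \<Omega> x p = span (x ` leaf \<Omega> x p)"

text \<open>
  A frame field is a matrix-valued map A whose u-th row is the frame vector with index u. The
  indices 0, ..., 4 are the elements of the type 5.
\<close>

definition adapted_frame ::
  "(real^3) set \<Rightarrow> (real^3 \<Rightarrow> real^5) \<Rightarrow> (real^3) set \<Rightarrow> (real^3 \<Rightarrow> real^5^5) \<Rightarrow> bool" where
  "adapted_frame \<Omega> x W A \<longleftrightarrow>
     open W \<and> W \<subseteq> \<Omega> \<and> smooth_on W A \<and>
     (\<forall>q\<in>W. invertible (A q) \<and> A q $ 0 = x q \<and>
        generator \<Omega> x q = span {A q $ 0, A q $ 1} \<and>
        tangent_space x q = span {A q $ 0, A q $ 1, A q $ 2, A q $ 3})"

text \<open>
  In matrix form, the equations dA_u = omega_u^v A_v read dA = omega A. The entry in row u and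
  column v of the following matrix is omega_u^v at the point q, evaluated at the tangent vector h.
\<close>

definition conn_form :: "(real^3 \<Rightarrow> real^5^5) \<Rightarrow> real^3 \<Rightarrow> real^3 \<Rightarrow> real^5^5" where
  "conn_form A q h = frechet_derivative A (at q) h ** matrix_inv (A q)"

text \<open>The row and column indices 1, 2 of C stand for the frame indices 2, 3.\<close>

definition frame_index :: "2 \<Rightarrow> 5" where
  "frame_index i = (if i = 1 then 2 else 3)"

definition focal_matrix :: "(real^3 \<Rightarrow> real^5^5) \<Rightarrow> real^3 \<Rightarrow> real^2^2 \<Rightarrow> bool" where
  "focal_matrix A q C \<longleftrightarrow>
     (\<forall>h i. conn_form A q h $ 1 $ frame_index i =
        (\<Sum>j\<in>UNIV. C $ i $ j * conn_form A q h $ 0 $ frame_index j))"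

definition foci :: "(real^3 \<Rightarrow> real^5^5) \<Rightarrow> real^3 \<Rightarrow> real^2^2 \<Rightarrow> (real^5) set" where
  "foci A q C =
     {a *\<^sub>R (A q $ 0) + b *\<^sub>R (A q $ 1) | a b.
        (a, b) \<noteq> (0, 0) \<and> det (a *\<^sub>R mat 1 + b *\<^sub>R C) = 0}"

text \<open>
  The determinant defining the foci, as a polynomial in the affine coordinate a on the line L
  (where b = 1). Its root 0 corresponds to the point A_1.
\<close>

definition focal_poly :: "real^2^2 \<Rightarrow> real poly" where
  "focal_poly C = det (\<chi> i j. [:C $ i $ j, if i = j then 1 else 0:])"

text \<open>
  A twisted cone. The map F is a lift of the map that sends a parameter to the focus of the
  generator through the corresponding point. The focus describes a curve if this map has rank one.
\<close>

definition twisted_cone :: "(real^3) set \<Rightarrow> (real^3 \<Rightarrow> real^5) \<Rightarrow> (real^3 \<Rightarrow> real^5) \<Rightarrow> bool" where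
  "twisted_cone \<Omega> x F \<longleftrightarrow>
     degenerate_gauss_map \<Omega> x 2 \<and>
     (\<forall>p\<in>\<Omega>. \<exists>W A. p \<in> W \<and> adapted_frame \<Omega> x W A \<and>
        (\<forall>q\<in>W. A q $ 1 = F q \<and>
           (\<exists>C. focal_matrix A q C \<and> C \<noteq> 0 \<and>
              foci A q C = {c *\<^sub>R F q | c. c \<noteq> 0} \<and> order 0 (focal_poly C) = 2))) \<and>
     (\<forall>p\<in>\<Omega>. proj_rank F p = 1)"

definition pencil :: "real^5 \<Rightarrow> (real^5) set \<Rightarrow> (real^5) set set" where
  "pencil c \<gamma> = {l. subspace l \<and> dim l = 2 \<and> c \<in> l \<and> l \<subseteq> \<gamma>}"

text \<open>
  A set of lines of a pencil is open if it is open in the quotient topology, where the points of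
  the plane other than the center are mapped to the lines joining them to the center.
\<close>

definition open_part_of_pencil ::
  "(real^5) set set \<Rightarrow> real^5 \<Rightarrow> (real^5) set \<Rightarrow> bool" where
  "open_part_of_pencil Ls c \<gamma> \<longleftrightarrow>
     Ls \<noteq> {} \<and> Ls \<subseteq> pencil c \<gamma> \<and>
     openin (top_of_set \<gamma>) {v\<in>\<gamma>. v \<notin> span {c} \<and> span {c, v} \<in> Ls}"

definition smooth_plane_family :: "real set \<Rightarrow> (real \<Rightarrow> (real^5) set) \<Rightarrow> bool" where
  "smooth_plane_family J \<gamma> \<longleftrightarrow>
     (\<forall>s\<in>J. subspace (\<gamma> s) \<and> dim (\<gamma> s) = 3) \<and>
     (\<exists>a b c. smooth_on J a \<and> smooth_on J b \<and> smooth_on J c \<and>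
        (\<forall>s\<in>J. \<gamma> s = span {a s, b s, c s}))"

end

theory Submission
  imports Defs
begin

text \<open>
  Write \<open>F\<close> for the double focus. Along a leaf the tangent hyperplane is constant, and the symmetry of
  the second derivative of \<open>x\<close> gives \<open>\<omega>\<^sub>1\<^sup>4 = 0\<close>, so that the derivatives of \<open>F\<close> stay in the tangent
  hyperplane. As \<open>[F]\<close> has rank one, it is locally \<open>g \<circ> t\<close> for a curve \<open>g\<close> and a submersion \<open>t\<close>.
  The matrix \<open>C\<close> sends \<open>dx\<close> to \<open>dF\<close> modulo the generator, and a nonzero nilpotent matrix of order 2
  has equal image and kernel. Hence if \<open>dt(h) = 0\<close>, then \<open>dx(h)\<close> is in the kernel of \<open>C\<close>, thus in its
  image, which is spanned by \<open>g'\<close>: on a fibre of \<open>t\<close> the derivatives of \<open>x\<close> lie in the span of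
  \<open>x\<close>, \<open>g\<close> and \<open>g'\<close>. Since \<open>g\<close> and \<open>g'\<close> are fixed there, the class of \<open>x\<close> modulo \<open>g\<close> and \<open>g'\<close>
  satisfies a linear equation \<open>du = a u\<close> and has a constant direction. So the plane spanned by
  \<open>x\<close>, \<open>g\<close> and \<open>g'\<close> depends only on \<open>t\<close>, and it is the plane of the pencil.
\<close>

subsection \<open>Smooth maps\<close>

text \<open>Three obstacles shape the argument. A leaf is only a connected component of a level set
  of the Gauss map and is not known to be a curve, so differentiation along it is replaced by a
  limit of secant directions; one limiting direction per point is enough, because conjugacy is a
  pointwise statement. The focus is given only up to scale, so rank one is a statement modulo
  \<open>F\<close>. Dividing by a linear functional puts the focus into an affine hyperplane; there
  the derivative has rank one in the ordinary sense, and the coordinate \<open>t\<close> can itself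
  be taken as a linear functional of the normalised focus. Finally, constancy on a fibre of
  \<open>t\<close> requires connected fibres. The neighbourhood is therefore taken as the image of a
  ball under a chart in which the fibres are flat slices, so that any two points of a fibre are
  joined by a segment. That the generators fill an open part of the pencil, and not just one line of
  it, comes from the other inclusion for \<open>C\<close>: its image lies in its kernel, which
  yields a direction in the kernel of \<open>dt\<close> along which the generator turns.\<close>

abbreviation fd :: "('a::real_normed_vector \<Rightarrow> 'b::real_normed_vector) \<Rightarrow> 'a \<Rightarrow> 'a \<Rightarrow> 'b" where
  "fd f q \<equiv> frechet_derivative f (at q)"

lemma fd_works: "f differentiable (at q) \<Longrightarrow> (f has_derivative fd f q) (at q)"
  by (simp add: frechet_derivative_works)

lemma fd_eqI: "(f has_derivative f') (at q) \<Longrightarrow> fd f q = f'"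
  by (metis frechet_derivative_at)

lemma fd_cong:
  assumes "open S" "q \<in> S" "\<And>x. x \<in> S \<Longrightarrow> f x = g x" "f differentiable (at q)"
  shows "(g has_derivative fd f q) (at q)" "fd g q = fd f q"
proof -
  show *: "(g has_derivative fd f q) (at q)"
    using has_derivative_transform_within_open[OF fd_works[OF assms(4)] assms(1,2)] assms(3) by blast
  show "fd g q = fd f q" by (rule fd_eqI[OF *])
qed

lemma diff_on_cong:
  assumes "open S" "diff_on k S f" "\<And>x. x \<in> S \<Longrightarrow> f x = g x"
  shows "diff_on k S g"
  using assms(2,3)
proof (induction k arbitrary: f g)
  case 0
  then show ?case by (metis continuous_on_cong diff_on.simps(1))
next
  case (Suc k)
  have "g differentiable (at q)" if "q \<in> S" for q
  proof -
    have "f differentiable (at q)" using Suc.prems(1) that by simp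
    from fd_cong(1)[OF assms(1) that Suc.prems(2) this] show ?thesis by (rule differentiableI)
  qed
  moreover have "diff_on k S (\<lambda>x. fd g x h)" for h
  proof (rule Suc.IH)
    show "diff_on k S (\<lambda>x. fd f x h)" using Suc.prems(1) by simp
    show "fd f x h = fd g x h" if "x \<in> S" for x
      using fd_cong(2)[OF assms(1) that Suc.prems(2)] Suc.prems(1) that by simp
  qed
  ultimately show ?case by simp
qed

lemma diff_on_SucD: "diff_on (Suc k) S f \<Longrightarrow> diff_on k S f"
proof (induction k arbitrary: f)
  case 0
  then show ?case
    by (simp add: continuous_at_imp_continuous_on differentiable_imp_continuous_within)
next
  case (Suc k)
  then show ?case by (metis diff_on.simps(2))
qed

lemma diff_on_subset: "diff_on k S f \<Longrightarrow> T \<subseteq> S \<Longrightarrow> diff_on k T f"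
  by (induction k arbitrary: f) (auto intro: continuous_on_subset)

text \<open>Lets the closure lemmas work with the explicit derivative of a sum, product or inverse;
  openness of \<open>S\<close> is what allows it to be exchanged for
  \<open>frechet_derivative\<close>.\<close>

lemma diff_on_SucI:
  assumes "open S" "\<And>x. x \<in> S \<Longrightarrow> (f has_derivative f' x) (at x)"
    and "\<And>h. diff_on k S (\<lambda>x. f' x h)"
  shows "diff_on (Suc k) S f"
proof -
  have "diff_on k S (\<lambda>x. fd f x h)" for h
    by (rule diff_on_cong[OF assms(1) assms(3)[of h]]) (simp add: fd_eqI[OF assms(2)])
  then show ?thesis using assms(2) by (auto simp: differentiable_def)
qed

lemma diff_on_SucD2:
  assumes "diff_on (Suc k) S f"
  shows "x \<in> S \<Longrightarrow> (f has_derivative fd f x) (at x)" "diff_on k S (\<lambda>x. fd f x h)"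
  using assms by (auto intro: fd_works)

lemma diff_on_add:
  "open S \<Longrightarrow> diff_on k S f \<Longrightarrow> diff_on k S g \<Longrightarrow> diff_on k S (\<lambda>x. f x + g x)"
proof (induction k arbitrary: f g)
  case 0
  then show ?case by (simp add: continuous_on_add)
next
  case (Suc k)
  note f = diff_on_SucD2[OF Suc.prems(2)] and g = diff_on_SucD2[OF Suc.prems(3)]
  have *: "diff_on k S (\<lambda>x. fd f x h + fd g x h)" for h
    by (rule Suc.IH[OF Suc.prems(1) f(2) g(2)])
  show ?case
    by (rule diff_on_SucI[OF Suc.prems(1) has_derivative_add[OF f(1) g(1)] *])
qed

lemma diff_on_linear:
  assumes "bounded_linear L" "open S" "diff_on k S f"
  shows "diff_on k S (\<lambda>x. L (f x))"
  using assms(3)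
proof (induction k arbitrary: f)
  case 0
  then show ?case by (simp add: bounded_linear.continuous_on[OF assms(1)])
next
  case (Suc k)
  note f = diff_on_SucD2[OF Suc.prems]
  have *: "diff_on k S (\<lambda>x. L (fd f x h))" for h
    by (rule Suc.IH[OF f(2)])
  show ?case
    by (rule diff_on_SucI[OF assms(2) bounded_linear.has_derivative[OF assms(1) f(1)] *])
qed

lemma diff_on_bilinear:
  assumes "bounded_bilinear B" "open S" "diff_on k S f" "diff_on k S g"
  shows "diff_on k S (\<lambda>x. B (f x) (g x))"
  using assms(3,4)
proof (induction k arbitrary: f g)
  case 0
  then show ?case by (simp add: bounded_bilinear.continuous_on[OF assms(1)])
next
  case (Suc k)
  note f = diff_on_SucD2[OF Suc.prems(1)] and g = diff_on_SucD2[OF Suc.prems(2)]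
  have *: "diff_on k S (\<lambda>x. B (f x) (fd g x h) + B (fd f x h) (g x))" for h
    using diff_on_add[OF assms(2) Suc.IH[OF diff_on_SucD[OF Suc.prems(1)] g(2)]
        Suc.IH[OF f(2) diff_on_SucD[OF Suc.prems(2)]]] .
  show ?case
    by (rule diff_on_SucI[OF assms(2) bounded_bilinear.FDERIV[OF assms(1) f(1) g(1)] *])
qed

lemma diff_on_inverse:
  fixes f :: "'a::euclidean_space \<Rightarrow> real"
  assumes "open S" "diff_on k S f" "\<And>x. x \<in> S \<Longrightarrow> f x \<noteq> 0"
  shows "diff_on k S (\<lambda>x. inverse (f x))"
  using assms(2)
proof (induction k)
  case 0
  then show ?case using assms(3) by (simp add: continuous_on_inverse)
next
  case (Suc k)
  note f = diff_on_SucD2[OF Suc.prems]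
  note m = diff_on_bilinear[OF bounded_bilinear_mult assms(1)]
  have i: "diff_on k S (\<lambda>x. inverse (f x))" by (rule Suc.IH[OF diff_on_SucD[OF Suc.prems]])
  have d: "((\<lambda>x. inverse (f x)) has_derivative (\<lambda>h. - (inverse (f x) * fd f x h * inverse (f x)))) (at x)"
    if "x \<in> S" for x
    using Deriv.has_derivative_inverse[OF assms(3)[OF that] f(1)[OF that]] .
  have "diff_on k S (\<lambda>x. - (inverse (f x) * fd f x h * inverse (f x)))" for h
    by (rule diff_on_linear[OF bounded_linear_minus[OF bounded_linear_ident] assms(1) m[OF m[OF i f(2)] i]])
  then show ?case by (intro diff_on_SucI[OF assms(1) d])
qed

text \<open>The curve is an integral curve of the field \<open>w h\<close>. The derivative of
  \<open>f\<close> along it is again a function on \<open>S\<close>, namely \<open>w\<close> times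
  the derivative of \<open>f\<close> in direction \<open>h\<close>, evaluated on the curve, so the
  induction closes without any higher derivatives of \<open>c\<close>.\<close>

lemma diff_on_curve:
  fixes c :: "real \<Rightarrow> 'a::euclidean_space"
  assumes S: "open S" and J: "open J" and cS: "\<And>s. s \<in> J \<Longrightarrow> c s \<in> S"
    and c': "\<And>s. s \<in> J \<Longrightarrow> (c has_derivative (\<lambda>r. (r * w (c s)) *\<^sub>R h)) (at s)"
    and w: "\<And>k. diff_on k S w"
  shows "diff_on k S f \<Longrightarrow> diff_on k J (\<lambda>s. f (c s))"
proof (induction k arbitrary: f)
  case 0
  have "continuous_on J c"
    by (meson c' continuous_at_imp_continuous_on has_derivative_continuous)
  then show ?case using 0 cS
    by (auto intro!: continuous_on_compose2[of S f J c])
next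
  case (Suc k)
  note f = diff_on_SucD2[OF Suc.prems]
  have d: "((\<lambda>s. f (c s)) has_derivative (\<lambda>r. r *\<^sub>R (w (c s) *\<^sub>R fd f (c s) h))) (at s)" if "s \<in> J" for s
    using has_derivative_compose[OF c'[OF that] f(1)[OF cS[OF that]]]
    by (simp add: linear_cmul[OF has_derivative_linear[OF f(1)[OF cS[OF that]]]])
  have "diff_on k S (\<lambda>q. w q *\<^sub>R fd f q h)"
    by (rule diff_on_bilinear[OF bounded_bilinear_scaleR S w f(2)])
  from Suc.IH[OF this] show ?case
    by (intro diff_on_SucI[OF J d] diff_on_linear[OF bounded_linear_scaleR_right J])
qed

lemma smooth_onD:
  assumes "smooth_on S f"
  shows "q \<in> S \<Longrightarrow> (f has_derivative fd f q) (at q)" "smooth_on S (\<lambda>q. fd f q h)"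
    "continuous_on S f"
proof -
  have *: "diff_on (Suc k) S f" for k using assms smooth_on_def by blast
  show "q \<in> S \<Longrightarrow> (f has_derivative fd f q) (at q)" by (rule diff_on_SucD2[OF *])
  show "smooth_on S (\<lambda>q. fd f q h)" using diff_on_SucD2(2)[OF *] smooth_on_def by blast
  show "continuous_on S f" using assms smooth_on_def diff_on.simps(1) by blast
qed

lemma smooth_on_bilinear:
  "bounded_bilinear B \<Longrightarrow> open S \<Longrightarrow> smooth_on S f \<Longrightarrow> smooth_on S g \<Longrightarrow> smooth_on S (\<lambda>x. B (f x) (g x))"
  unfolding smooth_on_def by (blast intro: diff_on_bilinear)

lemma smooth_on_linear:
  "bounded_linear L \<Longrightarrow> open S \<Longrightarrow> smooth_on S f \<Longrightarrow> smooth_on S (\<lambda>x. L (f x))"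
  unfolding smooth_on_def by (blast intro: diff_on_linear)

lemma smooth_on_inverse:
  fixes f :: "'a::euclidean_space \<Rightarrow> real"
  shows "open S \<Longrightarrow> smooth_on S f \<Longrightarrow> (\<And>x. x \<in> S \<Longrightarrow> f x \<noteq> 0) \<Longrightarrow> smooth_on S (\<lambda>x. inverse (f x))"
  unfolding smooth_on_def by (blast intro: diff_on_inverse)

lemma smooth_on_subset: "smooth_on S f \<Longrightarrow> T \<subseteq> S \<Longrightarrow> smooth_on T f"
  unfolding smooth_on_def by (blast intro: diff_on_subset)

text \<open>Serves to make the focus smooth on all of \<open>\<Omega>\<close>: it is a row of frame
  fields that exist only locally.\<close>

lemma smooth_on_local:
  fixes f :: "'a::euclidean_space \<Rightarrow> 'b::real_normed_vector"
  assumes "\<And>q. q \<in> S \<Longrightarrow> \<exists>W. open W \<and> q \<in> W \<and> smooth_on W f"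
  shows "smooth_on S f"
proof -
  have *: "diff_on k S f" if "\<And>q. q \<in> S \<Longrightarrow> \<exists>W. open W \<and> q \<in> W \<and> diff_on k W f" for k and f :: "'a \<Rightarrow> 'b"
    using that
  proof (induction k arbitrary: f)
    case 0
    show ?case unfolding diff_on.simps
    proof (rule continuous_at_imp_continuous_on, rule ballI)
      fix q assume "q \<in> S"
      then obtain W where "open W" "q \<in> W" "continuous_on W f" using 0 by auto
      then show "isCont f q" by (simp add: continuous_on_eq_continuous_at)
    qed
  next
    case (Suc k)
    have W: "\<exists>W. open W \<and> q \<in> W \<and> f differentiable (at q) \<and> (\<forall>h. diff_on k W (\<lambda>q. fd f q h))"
      if q: "q \<in> S" for q
    proof -
      obtain W where "open W" "q \<in> W" "diff_on (Suc k) W f" using Suc.prems[OF q] by blast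
      then show ?thesis by (intro exI[of _ W]) simp
    qed
    then have "f differentiable (at q)" if "q \<in> S" for q using that by blast
    moreover have "diff_on k S (\<lambda>q. fd f q h)" for h
    proof (rule Suc.IH)
      show "\<exists>W. open W \<and> q \<in> W \<and> diff_on k W (\<lambda>q. fd f q h)" if q: "q \<in> S" for q
        using W[OF q] by blast
    qed
    ultimately show ?case by simp
  qed
  show ?thesis unfolding smooth_on_def
  proof (intro allI *)
    show "\<exists>W. open W \<and> q \<in> W \<and> diff_on k W f" if "q \<in> S" for k q
      using assms[OF that] by (auto simp: smooth_on_def)
  qed
qed

lemma smooth_on_cong:
  "open S \<Longrightarrow> smooth_on S f \<Longrightarrow> (\<And>x. x \<in> S \<Longrightarrow> f x = g x) \<Longrightarrow> smooth_on S g"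
  unfolding smooth_on_def by (metis diff_on_cong)

section \<open>Symmetry of the second derivative\<close>

text \<open>The mean value theorem is used twice: in direction \<open>h\<close> for the increment of
  \<open>f\<close> along \<open>t k\<close>, then in direction \<open>k\<close> for the derivative
  \<open>f' q h\<close>.\<close>

lemma second_difference_mvt:
  fixes f :: "'a::real_normed_vector \<Rightarrow> real"
  assumes t: "0 < t" and sub: "\<And>a b. 0 \<le> a \<Longrightarrow> a \<le> t \<Longrightarrow> 0 \<le> b \<Longrightarrow> b \<le> t \<Longrightarrow> p + a *\<^sub>R h + b *\<^sub>R k \<in> S"
    and f: "\<And>q. q \<in> S \<Longrightarrow> (f has_derivative f' q) (at q)"
    and g: "\<And>q. q \<in> S \<Longrightarrow> ((\<lambda>q. f' q h) has_derivative g' q) (at q)"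
  shows "\<exists>a b. 0 < a \<and> a < t \<and> 0 < b \<and> b < t \<and>
    f (p + t *\<^sub>R h + t *\<^sub>R k) - f (p + t *\<^sub>R h) - f (p + t *\<^sub>R k) + f p = t * t * g' (p + a *\<^sub>R h + b *\<^sub>R k) k"
proof -
  define u where "u a = f (p + a *\<^sub>R h + t *\<^sub>R k) - f (p + a *\<^sub>R h)" for a
  have S0: "p + a *\<^sub>R h \<in> S" if "0 \<le> a" "a \<le> t" for a using sub[OF that, of 0] t by simp
  have lin: "linear (f' q)" "linear (g' q)" if "q \<in> S" for q
    using f[OF that] g[OF that] has_derivative_linear by blast+
  have du: "(u has_real_derivative (f' (p + a *\<^sub>R h + t *\<^sub>R k) h - f' (p + a *\<^sub>R h) h)) (at a)"
    if a: "0 \<le> a" "a \<le> t" for a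
  proof -
    have q1: "p + a *\<^sub>R h + t *\<^sub>R k \<in> S" and q2: "p + a *\<^sub>R h \<in> S" using sub[OF a, of t] S0[OF a] t by auto
    have "((\<lambda>a. f (p + a *\<^sub>R h + t *\<^sub>R k)) has_derivative (\<lambda>r. f' (p + a *\<^sub>R h + t *\<^sub>R k) (r *\<^sub>R h))) (at a)"
      by (rule has_derivative_compose[where f="\<lambda>a. p + a *\<^sub>R h + t *\<^sub>R k", OF _ f[OF q1]])
        (auto intro!: derivative_eq_intros)
    moreover have "((\<lambda>a. f (p + a *\<^sub>R h)) has_derivative (\<lambda>r. f' (p + a *\<^sub>R h) (r *\<^sub>R h))) (at a)"
      by (rule has_derivative_compose[where f="\<lambda>a. p + a *\<^sub>R h", OF _ f[OF q2]])
        (auto intro!: derivative_eq_intros)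
    ultimately have "(u has_derivative (\<lambda>r. f' (p + a *\<^sub>R h + t *\<^sub>R k) (r *\<^sub>R h) - f' (p + a *\<^sub>R h) (r *\<^sub>R h))) (at a)"
      unfolding u_def by (rule has_derivative_diff)
    moreover have "(\<lambda>r. f' (p + a *\<^sub>R h + t *\<^sub>R k) (r *\<^sub>R h) - f' (p + a *\<^sub>R h) (r *\<^sub>R h)) =
        (*) (f' (p + a *\<^sub>R h + t *\<^sub>R k) h - f' (p + a *\<^sub>R h) h)"
      unfolding linear_cmul[OF lin(1)[OF q1]] linear_cmul[OF lin(1)[OF q2]] fun_eq_iff
      by (simp only: real_scaleR_def left_diff_distrib right_diff_distrib mult.commute simp_thms)
    ultimately show ?thesis by (simp only: has_field_derivative_def)
  qed
  obtain a where a: "0 < a" "a < t"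
    and ua: "u t - u 0 = (t - 0) * (f' (p + a *\<^sub>R h + t *\<^sub>R k) h - f' (p + a *\<^sub>R h) h)"
    using MVT2[OF t du] by metis
  have dv: "((\<lambda>b. f' (p + a *\<^sub>R h + b *\<^sub>R k) h) has_real_derivative g' (p + a *\<^sub>R h + b *\<^sub>R k) k) (at b)"
    if b: "0 \<le> b" "b \<le> t" for b
  proof -
    have q: "p + a *\<^sub>R h + b *\<^sub>R k \<in> S" using sub[of a b] a b by auto
    have "((\<lambda>b. f' (p + a *\<^sub>R h + b *\<^sub>R k) h) has_derivative (\<lambda>r. g' (p + a *\<^sub>R h + b *\<^sub>R k) (r *\<^sub>R k))) (at b)"
      by (rule has_derivative_compose[where f="\<lambda>b. p + a *\<^sub>R h + b *\<^sub>R k", OF _ g[OF q]])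
        (auto intro!: derivative_eq_intros)
    then show ?thesis
      by (simp add: has_field_derivative_def linear_cmul[OF lin(2)[OF q]] mult_commute_abs)
  qed
  obtain b where b: "0 < b" "b < t"
    and vb: "f' (p + a *\<^sub>R h + t *\<^sub>R k) h - f' (p + a *\<^sub>R h + 0 *\<^sub>R k) h = (t - 0) * g' (p + a *\<^sub>R h + b *\<^sub>R k) k"
    using MVT2[OF t dv] by metis
  have "u t - u 0 = t * t * g' (p + a *\<^sub>R h + b *\<^sub>R k) k"
    using ua vb by simp
  then show ?thesis using a b unfolding u_def by (intro exI[of _ a] exI[of _ b]) simp
qed

text \<open>The second difference over a parallelogram does not change when \<open>h\<close> and
  \<open>k\<close> are exchanged, so the two mixed derivatives agree at two points close to
  \<open>p\<close>. By continuity they cannot differ at \<open>p\<close>.\<close>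

lemma second_derivative_symmetric_real:
  fixes f :: "'a::euclidean_space \<Rightarrow> real"
  assumes S: "open S" "p \<in> S" and f: "smooth_on S f"
  shows "fd (\<lambda>q. fd f q h) p k = fd (\<lambda>q. fd f q k) p h"
proof (rule ccontr)
  define G where "G h k = (\<lambda>q. fd (\<lambda>q. fd f q h) q k)" for h k
  assume "\<not> ?thesis"
  then have ne: "dist (G h k p) (G k h p) > 0" by (simp add: G_def)
  define e where "e = dist (G h k p) (G k h p) / 2"
  have e: "e > 0" unfolding e_def by (rule half_gt_zero[OF ne])
  have c: "continuous_on S (G h k)" for h k
    unfolding G_def using smooth_onD(3)[OF smooth_onD(2)[OF smooth_onD(2)[OF f]]] .
  have "\<exists>d>0. \<forall>q. dist q p < d \<longrightarrow> dist (G h k q) (G h k p) < e" for h k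
    using c[of h k] S e by (metis continuous_on_eq_continuous_at continuous_at_eps_delta)
  then obtain d1 d2 where d1: "d1 > 0" "\<And>q. dist q p < d1 \<Longrightarrow> dist (G h k q) (G h k p) < e"
    and d2: "d2 > 0" "\<And>q. dist q p < d2 \<Longrightarrow> dist (G k h q) (G k h p) < e" by metis
  obtain d3 where d3: "d3 > 0" "ball p d3 \<subseteq> S" using S open_contains_ball by blast
  define d where "d = min d1 (min d2 d3)"
  \<comment> \<open>The parallelogram with sides \<open>t h\<close> and \<open>t k\<close> then lies
    in the ball of radius \<open>d\<close>. The summand 1 makes the estimate strict and covers
    \<open>h = k = 0\<close>.\<close>
  define t where "t = d / (norm h + norm k + 1)"
  have d: "d > 0" using d1 d2 d3 d_def by simp
  have pos: "norm h + norm k + 1 > 0" by (simp add: add_nonneg_pos)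
  have t: "t > 0" using d pos t_def by simp
  have near: "dist (p + a *\<^sub>R h + b *\<^sub>R k) p < d" if "0 \<le> a" "a \<le> t" "0 \<le> b" "b \<le> t" for a b
  proof -
    have "norm (a *\<^sub>R h + b *\<^sub>R k) \<le> a * norm h + b * norm k"
      using norm_triangle_ineq[of "a *\<^sub>R h" "b *\<^sub>R k"] that by simp
    also have "\<dots> \<le> t * norm h + t * norm k" by (intro add_mono mult_right_mono that) auto
    also have "\<dots> < t * (norm h + norm k + 1)" using t by (simp add: algebra_simps)
    also have "\<dots> = d" using pos by (simp add: t_def)
    finally show ?thesis by (simp add: dist_norm add.assoc)
  qed
  have sub: "p + a *\<^sub>R h + b *\<^sub>R k \<in> S" "p + b *\<^sub>R k + a *\<^sub>R h \<in> S"
    if "0 \<le> a" "a \<le> t" "0 \<le> b" "b \<le> t" for a b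
    using near[OF that] d3(2) by (auto simp: d_def dist_commute mem_ball subset_iff algebra_simps)
  obtain a b where ab: "0 < a" "a < t" "0 < b" "b < t"
    and 1: "f (p + t *\<^sub>R h + t *\<^sub>R k) - f (p + t *\<^sub>R h) - f (p + t *\<^sub>R k) + f p
       = t * t * G h k (p + a *\<^sub>R h + b *\<^sub>R k)"
    using second_difference_mvt[OF t sub(1) smooth_onD(1)[OF f] smooth_onD(1)[OF smooth_onD(2)[OF f]]]
    unfolding G_def by blast
  obtain b' a' where ab': "0 < a'" "a' < t" "0 < b'" "b' < t"
    and 2: "f (p + t *\<^sub>R k + t *\<^sub>R h) - f (p + t *\<^sub>R k) - f (p + t *\<^sub>R h) + f p
       = t * t * G k h (p + b' *\<^sub>R k + a' *\<^sub>R h)"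
    using second_difference_mvt[OF t sub(2) smooth_onD(1)[OF f] smooth_onD(1)[OF smooth_onD(2)[OF f]]]
    unfolding G_def by blast
  have "t * t * G h k (p + a *\<^sub>R h + b *\<^sub>R k) = t * t * G k h (p + b' *\<^sub>R k + a' *\<^sub>R h)"
    using 1 2 by (simp add: algebra_simps)
  then have eq: "G h k (p + a *\<^sub>R h + b *\<^sub>R k) = G k h (p + b' *\<^sub>R k + a' *\<^sub>R h)" using t by simp
  have "dist (G h k (p + a *\<^sub>R h + b *\<^sub>R k)) (G h k p) < e"
    by (rule d1(2)) (use near[of a b] ab d_def in auto)
  moreover have "dist (G k h (p + b' *\<^sub>R k + a' *\<^sub>R h)) (G k h p) < e"
    by (rule d2(2)) (use near[of a' b'] ab' d_def in \<open>auto simp: algebra_simps\<close>)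
  ultimately have "dist (G h k p) (G k h p) < e + e"
    using dist_triangle_less_add by (metis eq dist_commute)
  then show False by (simp add: e_def)
qed

lemma second_derivative_symmetric:
  fixes f :: "'a::euclidean_space \<Rightarrow> 'b::real_inner"
  assumes S: "open S" "p \<in> S" and f: "smooth_on S f"
  shows "fd (\<lambda>q. fd f q h) p k = fd (\<lambda>q. fd f q k) p h"
proof -
  have bl: "bounded_linear (\<lambda>y. v \<bullet> y)" for v :: 'b by (rule bounded_linear_inner_right)
  have d1: "fd (\<lambda>q. v \<bullet> f q) q h = v \<bullet> fd f q h" if "q \<in> S" for q v h
    using fd_eqI[OF bounded_linear.has_derivative[OF bl smooth_onD(1)[OF f that]]] by simp
  have d2: "fd (\<lambda>q. fd (\<lambda>q. v \<bullet> f q) q h) p k = v \<bullet> fd (\<lambda>q. fd f q h) p k" for v h k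
  proof -
    have "((\<lambda>q. v \<bullet> fd f q h) has_derivative (\<lambda>k. v \<bullet> fd (\<lambda>q. fd f q h) p k)) (at p)"
      by (rule bounded_linear.has_derivative[OF bl smooth_onD(1)[OF smooth_onD(2)[OF f] S(2)]])
    from has_derivative_transform_within_open[OF this S(1,2)] d1
    have "((\<lambda>q. fd (\<lambda>q. v \<bullet> f q) q h) has_derivative (\<lambda>k. v \<bullet> fd (\<lambda>q. fd f q h) p k)) (at p)"
      by simp
    then show ?thesis by (simp add: fd_eqI)
  qed
  have "smooth_on S (\<lambda>q. v \<bullet> f q)" for v by (rule smooth_on_linear[OF bl S(1) f])
  from second_derivative_symmetric_real[OF S this]
  have "v \<bullet> fd (\<lambda>q. fd f q h) p k = v \<bullet> fd (\<lambda>q. fd f q k) p h" for v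
    unfolding d2 .
  then have "\<forall>v. v \<bullet> fd (\<lambda>q. fd f q h) p k = v \<bullet> fd (\<lambda>q. fd f q k) p h" ..
  then show ?thesis by (rule iffD1[OF vector_eq_ldot])
qed

subsection \<open>Linear algebra\<close>

lemma exhaust_5: "x = 0 \<or> x = 1 \<or> x = 2 \<or> x = 3 \<or> x = 4" for x :: 5
proof (induct x)
  case (of_int z)
  then have "0 \<le> z" "z < 5" by simp_all
  then have "z = 0 \<or> z = 1 \<or> z = 2 \<or> z = 3 \<or> z = 4" by arith
  then show ?case by auto
qed

lemma sum_5: "sum f (UNIV :: 5 set) = f 0 + f 1 + f 2 + f 3 + f 4"
proof -
  have U: "UNIV = {0, 1, 2, 3, 4 :: 5}" using exhaust_5 by auto
  show ?thesis unfolding U by (simp add: add.assoc)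
qed

text \<open>The polynomial is a^2 + (tr C) a + det C; divisibility by a^2 kills the trace and the
  determinant, so \<open>C\<close> is nilpotent.\<close>

lemma focal_poly_double_root:
  assumes "order 0 (focal_poly C) = 2"
  shows "C $ 1 $ 1 + C $ 2 $ 2 = 0" "C $ 1 $ 1 * C $ 2 $ 2 = C $ 1 $ 2 * C $ 2 $ 1"
proof -
  have p: "focal_poly C = [:C $ 1 $ 1 * C $ 2 $ 2 - C $ 1 $ 2 * C $ 2 $ 1, C $ 1 $ 1 + C $ 2 $ 2, 1:]"
    by (simp add: focal_poly_def det_2 algebra_simps)
  have "[:0, 1:] ^ 2 dvd focal_poly C"
    using order_1[of 0 "focal_poly C"] assms by simp
  then have "monom 1 2 dvd focal_poly C" by (simp add: monom_altdef)
  then have "\<forall>k<2. coeff (focal_poly C) k = 0" by (simp add: monom_1_dvd_iff')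
  then have "coeff (focal_poly C) 0 = 0" "coeff (focal_poly C) 1 = 0" by simp_all
  then show "C $ 1 $ 1 + C $ 2 $ 2 = 0" "C $ 1 $ 1 * C $ 2 $ 2 = C $ 1 $ 2 * C $ 2 $ 1"
    unfolding p by simp_all
qed

lemma parallel_2:
  fixes v1 v2 w1 w2 :: real
  assumes "v1 * w2 = v2 * w1" "w1 \<noteq> 0 \<or> w2 \<noteq> 0"
  shows "\<exists>r. v1 = r * w1 \<and> v2 = r * w2"
proof (cases "w1 = 0")
  case True
  then show ?thesis using assms by (intro exI[of _ "v2 / w2"]) simp
next
  case False
  then show ?thesis using assms(1) by (intro exI[of _ "v1 / w1"]) (simp add: field_simps)
qed

text \<open>The first two claims are C^2 = 0. The third says that the kernel lies in the line of any
  nonzero vector w = C u of the image: a traceless matrix is skew for the area form, so the area of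
  (v, C u) is a combination of the components of C v and vanishes with them.\<close>

lemma nilpotent_2:
  fixes C :: "real^2^2"
  assumes "C $ 1 $ 1 + C $ 2 $ 2 = 0" "C $ 1 $ 1 * C $ 2 $ 2 = C $ 1 $ 2 * C $ 2 $ 1"
    and w: "w1 = C $ 1 $ 1 * u1 + C $ 1 $ 2 * u2" "w2 = C $ 2 $ 1 * u1 + C $ 2 $ 2 * u2"
  shows "C $ 1 $ 1 * w1 + C $ 1 $ 2 * w2 = 0" "C $ 2 $ 1 * w1 + C $ 2 $ 2 * w2 = 0"
    "C $ 1 $ 1 * v1 + C $ 1 $ 2 * v2 = 0 \<Longrightarrow> C $ 2 $ 1 * v1 + C $ 2 $ 2 * v2 = 0 \<Longrightarrow>
      w1 \<noteq> 0 \<or> w2 \<noteq> 0 \<Longrightarrow> \<exists>r. v1 = r * w1 \<and> v2 = r * w2"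
proof -
  have C22: "C $ 2 $ 2 = - C $ 1 $ 1" using assms(1) by simp
  have det: "C $ 1 $ 1 * C $ 1 $ 1 + C $ 1 $ 2 * C $ 2 $ 1 = 0" using assms(2) C22 by simp
  have "C $ 1 $ 1 * w1 + C $ 1 $ 2 * w2 = (C $ 1 $ 1 * C $ 1 $ 1 + C $ 1 $ 2 * C $ 2 $ 1) * u1"
    unfolding w C22 by (simp add: algebra_simps)
  then show "C $ 1 $ 1 * w1 + C $ 1 $ 2 * w2 = 0" using det by simp
  have "C $ 2 $ 1 * w1 + C $ 2 $ 2 * w2 = (C $ 1 $ 1 * C $ 1 $ 1 + C $ 1 $ 2 * C $ 2 $ 1) * u2"
    unfolding w C22 by (simp add: algebra_simps)
  then show "C $ 2 $ 1 * w1 + C $ 2 $ 2 * w2 = 0" using det by simp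
  assume v: "C $ 1 $ 1 * v1 + C $ 1 $ 2 * v2 = 0" "C $ 2 $ 1 * v1 + C $ 2 $ 2 * v2 = 0"
    "w1 \<noteq> 0 \<or> w2 \<noteq> 0"
  have "v1 * w2 - v2 * w1 = u1 * (C $ 2 $ 1 * v1 + C $ 2 $ 2 * v2) - u2 * (C $ 1 $ 1 * v1 + C $ 1 $ 2 * v2)"
    unfolding w C22 by (simp add: algebra_simps)
  then show "\<exists>r. v1 = r * w1 \<and> v2 = r * w2" using parallel_2 v by simp
qed

section \<open>Spans of at most three vectors\<close>

lemma in_span_sing: "y \<in> span {a} \<longleftrightarrow> (\<exists>r. y = r *\<^sub>R a)"
  for a :: "'a::real_vector"
  by (auto simp: span_singleton)

lemma in_span_pair: "y \<in> span {a, b} \<longleftrightarrow> (\<exists>r s. y = r *\<^sub>R a + s *\<^sub>R b)"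
  for a :: "'a::real_vector"
  by (auto simp: span_breakdown_eq algebra_simps)

lemma in_span_triple: "y \<in> span {a, b, c} \<longleftrightarrow> (\<exists>r s t. y = r *\<^sub>R a + s *\<^sub>R b + t *\<^sub>R c)"
  for a :: "'a::real_vector"
  unfolding span_breakdown_eq[of _ a "{b, c}"] in_span_pair
  by (auto simp: algebra_simps)

lemma dim_span_pair: "a \<noteq> 0 \<Longrightarrow> b \<notin> span {a} \<Longrightarrow> dim (span {a, b}) = 2"
  for a b :: "'a::euclidean_space"
  by (simp add: insert_commute[of a b] dim_insert)

lemma parallel_if_orthogonal_subset:
  fixes a b :: "'a::real_inner"
  assumes "a \<noteq> 0" "\<And>y. a \<bullet> y = 0 \<Longrightarrow> b \<bullet> y = 0"
  shows "b \<in> span {a}"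
proof -
  define y where "y = b - ((a \<bullet> b) / (a \<bullet> a)) *\<^sub>R a"
  have "a \<bullet> y = 0" using assms(1) by (simp add: y_def inner_diff_right)
  then have "y \<bullet> y = 0" using assms(2)[of y] by (simp add: y_def inner_diff_left)
  then have "b = ((a \<bullet> b) / (a \<bullet> a)) *\<^sub>R a" by (simp add: y_def)
  then show ?thesis by (metis span_base span_scale insertI1)
qed

subsection \<open>The focus and the tangent hyperplane\<close>

text \<open>The difference quotients along the sequence lie in \<open>S\<close> and converge to
  \<open>f' h\<close>, and a subspace is closed. Only a sequence of points with convergent secant
  directions is required, which is all that a leaf offers.\<close>

lemma derivative_in_subspace:
  fixes f :: "'a::euclidean_space \<Rightarrow> 'b::euclidean_space"
  assumes f: "(f has_derivative f') (at q)" and S: "subspace S"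
    and pq: "p \<longlonglongrightarrow> q" "\<And>n. p n \<noteq> q" and pS: "\<And>n. f (p n) - f q \<in> S"
    and h: "(\<lambda>n. (p n - q) /\<^sub>R norm (p n - q)) \<longlonglongrightarrow> h"
  shows "f' h \<in> S"
proof -
  have bl: "bounded_linear f'" using f has_derivative_bounded_linear by blast
  have "filterlim p (at q) sequentially" using pq by (simp add: filterlim_at)
  moreover have "((\<lambda>y. (f y - f q - f' (y - q)) /\<^sub>R norm (y - q)) \<longlongrightarrow> 0) (at q)"
    using f by (simp add: has_derivative_at_within divide_inverse_commute)
  ultimately have 1: "(\<lambda>n. (f (p n) - f q - f' (p n - q)) /\<^sub>R norm (p n - q)) \<longlonglongrightarrow> 0"
    by (rule filterlim_compose[rotated])
  have 2: "(\<lambda>n. f' ((p n - q) /\<^sub>R norm (p n - q))) \<longlonglongrightarrow> f' h"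
    by (rule bounded_linear.tendsto[OF bl h])
  have "(f (p n) - f q - f' (p n - q)) /\<^sub>R norm (p n - q) + f' ((p n - q) /\<^sub>R norm (p n - q)) =
      (f (p n) - f q) /\<^sub>R norm (p n - q)" for n
    unfolding linear_cmul[OF bounded_linear.linear[OF bl]] scaleR_add_right[symmetric] diff_add_cancel ..
  then have lim: "(\<lambda>n. (f (p n) - f q) /\<^sub>R norm (p n - q)) \<longlonglongrightarrow> f' h"
    using tendsto_add[OF 1 2] by simp
  show ?thesis
    by (rule closed_sequentially[OF closed_subspace[OF S] subspace_scale[OF S pS] lim])
qed

text \<open>Otherwise \<open>x q\<close> and the images of two further basis vectors would span the
  tangent space, whose dimension is 4.\<close>

lemma immersion_derivative_inj:
  fixes x :: "real^3 \<Rightarrow> real^5"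
  assumes x: "(x has_derivative fd x q) (at q)" and r: "proj_rank x q = 3"
    and h: "fd x q h \<in> span {x q}"
  shows "h = 0"
proof (rule ccontr)
  assume "h \<noteq> 0"
  then have "independent {h}" by simp
  then obtain B where B: "{h} \<subseteq> B" "independent B" "UNIV \<subseteq> span B"
    using maximal_independent_subset_extend[of "{h}" UNIV] by (metis subset_UNIV)
  have finB: "finite B" using B(2) independent_imp_finite by blast
  have "card B = dim (UNIV :: (real^3) set)" by (rule basis_card_eq_dim[OF _ B(3,2)]) simp
  then have "card B = 3" by simp
  then have card: "card (B - {h}) = 2" using B(1) by simp
  let ?S = "insert (x q) (fd x q ` (B - {h}))"
  have lin: "linear (fd x q)" using has_derivative_linear[OF x] .
  have "fd x q ` B \<subseteq> span ?S"
  proof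
    fix y assume "y \<in> fd x q ` B"
    then obtain b where b: "b \<in> B" "y = fd x q b" by blast
    show "y \<in> span ?S"
    proof (cases "b = h")
      case True
      then show ?thesis using b h span_mono[of "{x q}" ?S] by auto
    next
      case False
      then show ?thesis using b by (auto intro: span_base)
    qed
  qed
  then have "span (fd x q ` B) \<subseteq> span ?S" by (simp add: span_minimal)
  moreover have "span (fd x q ` B) = range (fd x q)"
    using B(3) by (metis linear_span_image[OF lin] top.extremum_uniqueI)
  ultimately have "insert (x q) (range (fd x q)) \<subseteq> span ?S" by (simp add: span_base)
  then have "tangent_space x q \<subseteq> span ?S" unfolding tangent_space_def by (simp add: span_minimal)
  then have "dim (tangent_space x q) \<le> dim ?S" by (metis dim_span dim_subset)
  also have "\<dots> \<le> card ?S" by (rule dim_le_card') (use finB in simp)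
  also have "\<dots> \<le> Suc (card (fd x q ` (B - {h})))" by (rule card_insert_le_m1) auto
  also have "\<dots> \<le> 3" using card_image_le[of "B - {h}" "fd x q"] finB card by simp
  finally show False using r unfolding proj_rank_def by simp
qed

text \<open>This is the equation \<open>\<omega>\<^sub>1\<^sup>4 = 0\<close>: a limiting direction \<open>h\<close> of the leaf through \<open>q\<close> is conjugate
  to every direction, and \<open>F q\<close> lies in the span of \<open>x q\<close> and the derivative of \<open>x\<close> along \<open>h\<close>.\<close>

lemma derivative_on_generator_in_tangent_space:
  assumes x: "hypersurface \<Omega> x" and \<xi>: "gauss_lift \<Omega> x \<xi>" and q: "q \<in> \<Omega>"
    and F: "(F has_derivative fd F q) (at q)"
    and W: "open W" "q \<in> W" "\<And>p. p \<in> W \<Longrightarrow> p \<in> \<Omega> \<and> F p \<in> tangent_space x p"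
    and gen: "generator \<Omega> x q = span {x q, F q}" and ind: "F q \<notin> span {x q}"
  shows "fd F q k \<in> tangent_space x q"
proof -
  define M where "M = {p\<in>\<Omega>. tangent_space x p = tangent_space x q}"
  define L where "L = leaf \<Omega> x q"
  have \<Omega>: "open \<Omega>" and sx: "smooth_on \<Omega> x" and sxi: "smooth_on \<Omega> \<xi>"
    using x \<xi> by (auto simp: hypersurface_def gauss_lift_def)
  have T: "tangent_space x p = {y. \<xi> p \<bullet> y = 0}" "\<xi> p \<noteq> 0" if "p \<in> \<Omega>" for p
    using \<xi> that by (auto simp: gauss_lift_def)
  have L: "connected L" "q \<in> L" "L \<subseteq> M"
    unfolding L_def leaf_def M_def[symmetric] using q
    by (auto simp: connected_component_subset M_def connected_component_refl_eq intro: connected_component_in)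
  \<comment> \<open>A one-point leaf would have only the point \<open>x q\<close> as its generator,
    but the generator also contains the focus.\<close>
  have "L \<noteq> {q}"
  proof
    assume "L = {q}"
    then have "F q \<in> span {x q}"
      using gen span_base[of "F q" "{x q, F q}"] by (simp add: generator_def L_def)
    then show False using ind by simp
  qed
  \<comment> \<open>A connected set with more than one point has no isolated points. So
    \<open>q\<close> is a limit of other points of the leaf, and compactness of the unit sphere
    gives a limiting secant direction \<open>h\<close>, which is nonzero.\<close>
  then have "q islimpt L" using L connected_imp_perfect[of L q] by (metis singletonD insertI1)
  then obtain p where p: "\<And>n. p n \<in> L - {q}" "p \<longlonglongrightarrow> q" unfolding islimpt_sequential by auto
  define v where "v n = (p n - q) /\<^sub>R norm (p n - q)" for n
  have "norm (v n) = 1" for n using p(1)[of n] by (simp add: v_def)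
  then have "\<forall>n. v n \<in> sphere 0 1" by simp
  then obtain h r where h: "h \<in> sphere 0 1" "strict_mono r" "(v \<circ> r) \<longlonglongrightarrow> h"
    using compact_sphere unfolding compact_def by metis
  have h0: "h \<noteq> 0" using h(1) by auto
  have pr: "(p \<circ> r) \<longlonglongrightarrow> q" "(p \<circ> r) n \<noteq> q" "(p \<circ> r) n \<in> L" for n
    using LIMSEQ_subseq_LIMSEQ[OF p(2) h(2)] p(1) by auto
  have hv: "(\<lambda>n. ((p \<circ> r) n - q) /\<^sub>R norm ((p \<circ> r) n - q)) \<longlonglongrightarrow> h"
    using h(3) by (simp add: v_def comp_def)
  have xL: "x y \<in> span {x q, F q}" if "y \<in> L" for y
    using that gen by (metis L_def generator_def imageI span_base)
  have dxh: "fd x q h \<in> span {x q, F q}"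
    by (rule derivative_in_subspace[OF smooth_onD(1)[OF sx q] subspace_span pr(1,2) _ hv])
      (use xL[OF pr(3)] in \<open>auto intro: span_diff span_base\<close>)
  \<comment> \<open>The tangent hyperplane is the same along the leaf, so the values of
    \<open>\<xi>\<close> there are multiples of \<open>\<xi> q\<close>; hence so is the derivative
    of \<open>\<xi>\<close> along \<open>h\<close>.\<close>
  have xiL: "\<xi> y \<in> span {\<xi> q}" if "y \<in> L" for y
  proof -
    have y: "y \<in> \<Omega>" "tangent_space x y = tangent_space x q" using L(3) that by (auto simp: M_def)
    have "\<xi> y \<bullet> z = 0" if "\<xi> q \<bullet> z = 0" for z
      using y(2) that unfolding T(1)[OF y(1)] T(1)[OF q] by blast
    then show ?thesis by (rule parallel_if_orthogonal_subset[OF T(2)[OF q]])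
  qed
  have dxih: "fd \<xi> q h \<in> span {\<xi> q}"
    by (rule derivative_in_subspace[OF smooth_onD(1)[OF sxi q] subspace_span pr(1,2) _ hv])
      (use xiL[OF pr(3)] in \<open>auto intro: span_diff span_base\<close>)
  have "fd x q h \<notin> span {x q}"
    using immersion_derivative_inj[OF smooth_onD(1)[OF sx q]] h0 x q by (auto simp: hypersurface_def)
  moreover obtain a b where ab: "fd x q h = a *\<^sub>R x q + b *\<^sub>R F q" using dxh in_span_pair by metis
  ultimately have b: "b \<noteq> 0" by (metis add.right_neutral scaleR_zero_left span_base span_scale insertI1)
  \<comment> \<open>The derivative of the identity \<open>\<xi> \<bullet> G = 0\<close>, to be
    applied with \<open>G\<close> equal to \<open>x\<close>, to a derivative of \<open>x\<close>,
    and to \<open>F\<close>.\<close>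
  have prod: "fd \<xi> q k \<bullet> G q + \<xi> q \<bullet> fd G q k = 0"
    if "(G has_derivative fd G q) (at q)" "\<And>p. p \<in> W \<Longrightarrow> G p \<in> tangent_space x p" for G k
  proof -
    have "((\<lambda>p. \<xi> p \<bullet> G p) has_derivative (\<lambda>k. \<xi> q \<bullet> fd G q k + fd \<xi> q k \<bullet> G q)) (at q)"
      by (rule has_derivative_inner[OF smooth_onD(1)[OF sxi q] that(1)])
    moreover have "0 = \<xi> p \<bullet> G p" if "p \<in> W" for p
      using \<open>\<And>p. p \<in> W \<Longrightarrow> G p \<in> tangent_space x p\<close>[OF that] T(1)[of p] W(3)[OF that] by simp
    then have "((\<lambda>p. \<xi> p \<bullet> G p) has_derivative (\<lambda>k. 0)) (at q)"
      by (rule has_derivative_transform_within_open[OF has_derivative_const W(1,2)])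
    ultimately have "(\<lambda>k. \<xi> q \<bullet> fd G q k + fd \<xi> q k \<bullet> G q) = (\<lambda>k. 0)"
      by (rule has_derivative_unique)
    from fun_cong[OF this, of k] show ?thesis by simp
  qed
  have dxT: "fd x p k \<in> tangent_space x p" "x p \<in> tangent_space x p" for p k
    by (auto simp: tangent_space_def intro: span_base)
  have \<xi>dx: "\<xi> q \<bullet> fd x q k = 0" for k using dxT T(1)[OF q] by blast
  note ddx = smooth_onD(1)[OF smooth_onD(2)[OF sx] q]
  have x1: "fd \<xi> q k \<bullet> x q = 0" using prod[OF smooth_onD(1)[OF sx q] dxT(2)] \<xi>dx by simp
  have "fd \<xi> q h \<bullet> fd x q k = 0"
    using dxih \<xi>dx by (auto simp: span_singleton)
  then have "\<xi> q \<bullet> fd (\<lambda>p. fd x p k) q h = 0" using prod[OF ddx dxT(1), of h k] by simp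
  \<comment> \<open>The second fundamental form is symmetric, so \<open>h\<close> and
    \<open>k\<close> may be exchanged; now \<open>\<xi>\<close> is differentiated along the
    arbitrary \<open>k\<close>.\<close>
  then have "\<xi> q \<bullet> fd (\<lambda>p. fd x p h) q k = 0"
    using second_derivative_symmetric[OF \<Omega> q sx] by metis
  then have "fd \<xi> q k \<bullet> fd x q h = 0" using prod[OF ddx dxT(1), of k h] by simp
  \<comment> \<open>Modulo \<open>x q\<close> the vector \<open>fd x q h\<close> is a nonzero
    multiple of \<open>F q\<close>, by \<open>ab\<close> and \<open>b\<close>.\<close>
  then have "fd \<xi> q k \<bullet> F q = 0" using x1 b unfolding ab by (simp add: inner_add_right)
  then have "\<xi> q \<bullet> fd F q k = 0" using prod[OF F, of k] W(3) by simp
  then show ?thesis using T(1)[OF q] by simp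
qed

subsection \<open>The focal matrix\<close>

lemma adapted_frame_derivatives:
  assumes fr: "adapted_frame \<Omega> x W A" and q: "q \<in> W" and AF: "\<And>p. p \<in> W \<Longrightarrow> A p $ 1 = F p"
  shows "fd A q h $ 0 = fd x q h" "fd A q h $ 1 = fd F q h" "(F has_derivative fd F q) (at q)"
    "smooth_on W F"
proof -
  have W: "open W" "smooth_on W A" and A0: "\<And>p. p \<in> W \<Longrightarrow> A p $ 0 = x p"
    using fr by (auto simp: adapted_frame_def)
  have 1: "((\<lambda>p. A p $ i) has_derivative (\<lambda>h. fd A q h $ i)) (at q)" for i
    by (rule bounded_linear.has_derivative[OF bounded_linear_vec_nth smooth_onD(1)[OF W(2) q]])
  have x: "(x has_derivative (\<lambda>h. fd A q h $ 0)) (at q)"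
    by (rule has_derivative_transform_within_open[OF 1 W(1) q]) (rule A0)
  have F: "(F has_derivative (\<lambda>h. fd A q h $ 1)) (at q)"
    by (rule has_derivative_transform_within_open[OF 1 W(1) q]) (rule AF)
  show "fd A q h $ 0 = fd x q h" "fd A q h $ 1 = fd F q h" "(F has_derivative fd F q) (at q)"
    using fd_eqI[OF x] fd_eqI[OF F] F by auto
  have "smooth_on W (\<lambda>p. A p $ 1)"
    by (rule smooth_on_linear[OF bounded_linear_vec_nth W])
  then show "smooth_on W F" by (rule smooth_on_cong[OF W(1)]) (rule AF)
qed

lemma vector_matrix_mult_rows: "c v* A = (\<Sum>i\<in>UNIV. c $ i *\<^sub>R A $ i)"
  for A :: "real^'n^'m"
  by (simp add: vec_eq_iff vector_matrix_mult_def mult.commute)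

lemma matrix_mult_row: "(A ** B) $ i = A $ i v* B"
  for A :: "real^'n^'m"
  by (simp add: vec_eq_iff vector_matrix_mult_def matrix_matrix_mult_def mult.commute)

lemma matrix_inv_mult:
  assumes "invertible A"
  shows "A ** matrix_inv A = mat 1" "matrix_inv A ** A = mat 1"
  using someI_ex[OF assms[unfolded invertible_def]] unfolding matrix_inv_def by auto

text \<open>Modulo the generator the tangent hyperplane has the coordinates with frame indices 2 and
  3, and there \<open>C\<close> sends \<open>dx\<close> to \<open>dF\<close>. As \<open>dx\<close>
  is onto, the three claims express that \<open>C\<close> is nonzero, that its kernel lies in its
  image, and that its image lies in its kernel.\<close>

lemma double_focus_facts:
  assumes fr: "adapted_frame \<Omega> x W A" and q: "q \<in> W" and AF: "\<And>p. p \<in> W \<Longrightarrow> A p $ 1 = F p"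
    and C: "focal_matrix A q C" "C \<noteq> 0" "order 0 (focal_poly C) = 2"
    and T: "\<And>k. fd F q k \<in> tangent_space x q"
    and dx: "linear (fd x q)"
  shows "\<exists>k. fd F q k \<notin> span {x q, F q}"
    "fd F q h \<in> span {x q, F q} \<Longrightarrow> fd F q k \<notin> span {x q, F q} \<Longrightarrow> fd x q h \<in> span {x q, F q, fd F q k}"
    "\<exists>h. fd F q h \<in> span {x q, F q} \<and> fd x q h \<notin> span {x q, F q}"
proof -
  define N where "N = matrix_inv (A q)"
  \<comment> \<open>\<open>K y\<close> is the coordinate vector of \<open>y\<close> in the frame at
    \<open>q\<close>.\<close>
  define K where "K y = y v* N" for y
  have inv: "invertible (A q)" and A0: "A q $ 0 = x q" and A1: "A q $ 1 = F q"
    and tan: "tangent_space x q = span {A q $ 0, A q $ 1, A q $ 2, A q $ 3}"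
    using fr q AF[OF q] by (auto simp: adapted_frame_def)
  have NA: "N ** A q = mat 1" "A q ** N = mat 1"
    using matrix_inv_mult[OF inv] by (auto simp: N_def)
  have Kadd: "K (y + z) = K y + K z" and Kscale: "K (r *\<^sub>R y) = r *\<^sub>R K y" for y z r
    by (simp_all add: K_def vec_eq_iff vector_matrix_mult_def sum.distrib algebra_simps sum_distrib_left)
  have KA: "K (A q $ i) $ j = (if i = j then 1 else 0)" for i j
    using arg_cong[OF NA(2), of "\<lambda>M. M $ i $ j"] by (simp add: K_def matrix_mult_row mat_def)
  have Ky: "y = K y $ 0 *\<^sub>R A q $ 0 + K y $ 1 *\<^sub>R A q $ 1 + K y $ 2 *\<^sub>R A q $ 2 + K y $ 3 *\<^sub>R A q $ 3
      + K y $ 4 *\<^sub>R A q $ 4" for y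
  proof -
    have "y = K y v* A q" by (simp add: K_def vector_matrix_mul_assoc NA)
    then show ?thesis by (simp add: vector_matrix_mult_rows sum_5)
  qed
  have L: "y \<in> span {x q, F q} \<longleftrightarrow> K y $ 2 = 0 \<and> K y $ 3 = 0 \<and> K y $ 4 = 0" for y
  proof
    assume "y \<in> span {x q, F q}"
    then show "K y $ 2 = 0 \<and> K y $ 3 = 0 \<and> K y $ 4 = 0"
      unfolding in_span_pair A0[symmetric] A1[symmetric] by (auto simp: Kadd Kscale KA)
  next
    assume "K y $ 2 = 0 \<and> K y $ 3 = 0 \<and> K y $ 4 = 0"
    then show "y \<in> span {x q, F q}" using Ky[of y] unfolding in_span_pair A0 A1 by auto
  qed
  have T4: "K y $ 4 = 0" if "y \<in> tangent_space x q" for y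
    using that unfolding tan span_breakdown_eq[of y] in_span_triple
    by (auto simp: algebra_simps Kadd Kscale KA)
  \<comment> \<open>The tangent hyperplane is the sum of the range of \<open>dx\<close> and the line
    of \<open>x q\<close>, which has no coordinates 2 and 3.\<close>
  have surj: "\<exists>h. K (fd x q h) $ 2 = u \<and> K (fd x q h) $ 3 = v" for u v
  proof -
    have "u *\<^sub>R A q $ 2 + v *\<^sub>R A q $ 3 \<in> span (insert (x q) (range (fd x q)))"
      unfolding tangent_space_def[symmetric] tan by (intro span_add span_scale span_base) auto
    then obtain r where "u *\<^sub>R A q $ 2 + v *\<^sub>R A q $ 3 - r *\<^sub>R x q \<in> range (fd x q)"
      unfolding span_breakdown_eq span_eq_iff[THEN iffD2, OF linear_subspace_image[OF dx subspace_UNIV]]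
      by blast
    then obtain h where "u *\<^sub>R A q $ 2 + v *\<^sub>R A q $ 3 - r *\<^sub>R x q = fd x q h" by blast
    then have h: "fd x q h = u *\<^sub>R A q $ 2 + v *\<^sub>R A q $ 3 + (- r) *\<^sub>R A q $ 0" by (simp add: A0)
    show ?thesis by (intro exI[of _ h]) (simp only: h Kadd Kscale vector_add_component vector_scaleR_component KA, simp)
  qed
  have conn: "conn_form A q h $ 0 = K (fd x q h)" "conn_form A q h $ 1 = K (fd F q h)" for h
    using adapted_frame_derivatives(1,2)[OF fr q AF] by (auto simp: conn_form_def matrix_mult_row K_def N_def)
  have foc: "K (fd F q h) $ 2 = C $ 1 $ 1 * K (fd x q h) $ 2 + C $ 1 $ 2 * K (fd x q h) $ 3"
    "K (fd F q h) $ 3 = C $ 2 $ 1 * K (fd x q h) $ 2 + C $ 2 $ 2 * K (fd x q h) $ 3" for h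
    using C(1)[unfolded focal_matrix_def, THEN spec, of h, THEN spec, of 1]
      C(1)[unfolded focal_matrix_def, THEN spec, of h, THEN spec, of 2]
    by (simp_all add: conn frame_index_def sum_2)
  note nil = nilpotent_2[OF focal_poly_double_root[OF C(3)]]
  have dF: "fd F q k \<in> span {x q, F q} \<longleftrightarrow> K (fd F q k) $ 2 = 0 \<and> K (fd F q k) $ 3 = 0" for k
    using L T4[OF T] by simp
  have "\<exists>u v. C $ 1 $ 1 * u + C $ 1 $ 2 * v \<noteq> 0 \<or> C $ 2 $ 1 * u + C $ 2 $ 2 * v \<noteq> 0"
  proof (rule ccontr)
    assume "\<not> ?thesis"
    then have 0: "C $ 1 $ 1 * u + C $ 1 $ 2 * v = 0" "C $ 2 $ 1 * u + C $ 2 $ 2 * v = 0" for u v by auto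
    show False using 0[of 1 0] 0[of 0 1] C(2) by (simp add: vec_eq_iff forall_2)
  qed
  then obtain u v where "C $ 1 $ 1 * u + C $ 1 $ 2 * v \<noteq> 0 \<or> C $ 2 $ 1 * u + C $ 2 $ 2 * v \<noteq> 0" by blast
  moreover obtain k where "K (fd x q k) $ 2 = u" "K (fd x q k) $ 3 = v" using surj by blast
  ultimately have k: "K (fd F q k) $ 2 \<noteq> 0 \<or> K (fd F q k) $ 3 \<noteq> 0" by (simp add: foc)
  then show "\<exists>k. fd F q k \<notin> span {x q, F q}" using dF by blast
  \<comment> \<open>This \<open>h\<close> realises by \<open>dx\<close> the nonzero image vector of
    \<open>C\<close> attained at \<open>k\<close>; applying \<open>C\<close> once more gives
    zero.\<close>
  obtain h where h: "K (fd x q h) $ 2 = K (fd F q k) $ 2" "K (fd x q h) $ 3 = K (fd F q k) $ 3"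
    using surj by blast
  have "K (fd F q h) $ 2 = 0" "K (fd F q h) $ 3 = 0"
    using nil(1,2)[OF foc(1)[of k] foc(2)[of k]] foc[of h] unfolding h by auto
  then show "\<exists>h. fd F q h \<in> span {x q, F q} \<and> fd x q h \<notin> span {x q, F q}"
    using dF L h k by metis
  show "fd x q h \<in> span {x q, F q, fd F q k}"
    if h: "fd F q h \<in> span {x q, F q}" and k: "fd F q k \<notin> span {x q, F q}" for h k
  proof -
    \<comment> \<open>Here the kernel vector \<open>dx(h)\<close> is compared with the nonzero image
      vector \<open>dF(k)\<close>.\<close>
    obtain r where r: "K (fd x q h) $ 2 = r * K (fd F q k) $ 2" "K (fd x q h) $ 3 = r * K (fd F q k) $ 3"
      using nil(3)[OF foc(1)[of k] foc(2)[of k], of "K (fd x q h) $ 2" "K (fd x q h) $ 3"]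
        foc[of h] h k dF by auto
    have "fd x q h \<in> tangent_space x q" by (simp add: tangent_space_def span_base)
    then have "fd x q h + (- r) *\<^sub>R fd F q k \<in> span {x q, F q}"
      unfolding L Kadd Kscale using r T4 T by simp
    then obtain a b where "fd x q h + (- r) *\<^sub>R fd F q k = a *\<^sub>R x q + b *\<^sub>R F q"
      using in_span_pair by metis
    then have "fd x q h = a *\<^sub>R x q + b *\<^sub>R F q + r *\<^sub>R fd F q k" by (simp add: algebra_simps)
    then show ?thesis using in_span_triple by blast
  qed
qed

lemma adapted_frame_independent:
  assumes fr: "adapted_frame \<Omega> x W A" and q: "q \<in> W" and AF: "A q $ 1 = F q"
  shows "F q \<notin> span {x q}" "x q \<notin> span {F q}"
proof -
  have inv: "invertible (A q)" and A0: "A q $ 0 = x q"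
    using fr q by (auto simp: adapted_frame_def)
  have NA: "A q ** matrix_inv (A q) = mat 1" using matrix_inv_mult(1)[OF inv] .
  define K where "K y = y v* matrix_inv (A q)" for y
  have Kscale: "K (r *\<^sub>R y) = r *\<^sub>R K y" for y r
    by (simp add: K_def vec_eq_iff vector_matrix_mult_def sum_distrib_left algebra_simps)
  have KA: "K (A q $ i) $ j = (if i = j then 1 else 0)" for i j
    using arg_cong[OF NA, of "\<lambda>M. M $ i $ j"] by (simp add: K_def matrix_mult_row mat_def)
  have "A q $ i \<noteq> r *\<^sub>R A q $ j" if "i \<noteq> j" for i j r
  proof
    assume "A q $ i = r *\<^sub>R A q $ j"
    then have "K (A q $ i) $ i = r * K (A q $ j) $ i" by (metis Kscale vector_scaleR_component real_scaleR_def)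
    then show False using that by (simp add: KA)
  qed
  from this[of 1 0] this[of 0 1] show "F q \<notin> span {x q}" "x q \<notin> span {F q}"
    by (auto simp: span_singleton A0 AF)
qed

text \<open>Collects what the rest of the proof uses of a twisted cone. Frames, the Gauss lift and
  the matrix \<open>C\<close> do not appear in the conclusions, which are conditions on
  \<open>x\<close> and \<open>F\<close> alone.\<close>

lemma twisted_cone_facts:
  assumes tc: "twisted_cone \<Omega> x F"
  shows "open \<Omega>" "smooth_on \<Omega> x" "smooth_on \<Omega> F"
    and "q \<in> \<Omega> \<Longrightarrow> generator \<Omega> x q = span {x q, F q}"
    and "q \<in> \<Omega> \<Longrightarrow> F q \<notin> span {x q}" "q \<in> \<Omega> \<Longrightarrow> x q \<notin> span {F q}"
    and "q \<in> \<Omega> \<Longrightarrow> proj_rank F q = 1"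
    and "q \<in> \<Omega> \<Longrightarrow> \<exists>k. fd F q k \<notin> span {x q, F q}"
    and "q \<in> \<Omega> \<Longrightarrow> fd F q h \<in> span {x q, F q} \<Longrightarrow> fd F q k \<notin> span {x q, F q} \<Longrightarrow>
      fd x q h \<in> span {x q, F q, fd F q k}"
    and "q \<in> \<Omega> \<Longrightarrow> \<exists>h. fd F q h \<in> span {x q, F q} \<and> fd x q h \<notin> span {x q, F q}"
proof -
  obtain \<xi> where hyp: "hypersurface \<Omega> x" and \<xi>: "gauss_lift \<Omega> x \<xi>"
    using tc by (auto simp: twisted_cone_def degenerate_gauss_map_def)
  show O: "open \<Omega>" and sx: "smooth_on \<Omega> x" using hyp by (auto simp: hypersurface_def)
  show rk: "proj_rank F q = 1" if "q \<in> \<Omega>" for q using tc that by (simp add: twisted_cone_def)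
  have frame: "\<exists>W A. p \<in> W \<and> adapted_frame \<Omega> x W A \<and> (\<forall>q\<in>W. A q $ 1 = F q \<and>
      (\<exists>C. focal_matrix A q C \<and> C \<noteq> 0 \<and> order 0 (focal_poly C) = 2))" if p: "p \<in> \<Omega>" for p
  proof -
    obtain W A where W: "p \<in> W" "adapted_frame \<Omega> x W A" and WA: "\<forall>q\<in>W. A q $ 1 = F q \<and>
        (\<exists>C. focal_matrix A q C \<and> C \<noteq> 0 \<and>
          foci A q C = {c *\<^sub>R F q | c. c \<noteq> 0} \<and> order 0 (focal_poly C) = 2)"
      using bspec[OF conjunct1[OF conjunct2[OF tc[unfolded twisted_cone_def]]] p] by (elim exE conjE)
    have "A q $ 1 = F q \<and> (\<exists>C. focal_matrix A q C \<and> C \<noteq> 0 \<and> order 0 (focal_poly C) = 2)"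
      if "q \<in> W" for q
      using bspec[OF WA that] by (elim exE conjE) (intro conjI exI; assumption)
    then show ?thesis using W by (intro exI[of _ W] exI[of _ A]) simp
  qed
  show "smooth_on \<Omega> F"
  proof (rule smooth_on_local)
    fix q assume "q \<in> \<Omega>"
    from frame[OF this] obtain W A where W: "q \<in> W" "adapted_frame \<Omega> x W A"
      and WA: "\<forall>q\<in>W. A q $ 1 = F q \<and>
        (\<exists>C. focal_matrix A q C \<and> C \<noteq> 0 \<and> order 0 (focal_poly C) = 2)"
      by (elim exE conjE)
    have "smooth_on W F" by (rule adapted_frame_derivatives(4)[OF W(2,1)]) (use WA in simp)
    moreover have "open W" using W(2) by (simp add: adapted_frame_def)
    ultimately show "\<exists>W. open W \<and> q \<in> W \<and> smooth_on W F" using W(1) by blast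
  qed
  have *: "generator \<Omega> x q = span {x q, F q} \<and> F q \<notin> span {x q} \<and> x q \<notin> span {F q} \<and>
     (\<exists>k. fd F q k \<notin> span {x q, F q}) \<and>
     (fd F q h \<in> span {x q, F q} \<longrightarrow> fd F q k \<notin> span {x q, F q} \<longrightarrow> fd x q h \<in> span {x q, F q, fd F q k}) \<and>
     (\<exists>h. fd F q h \<in> span {x q, F q} \<and> fd x q h \<notin> span {x q, F q})" if q: "q \<in> \<Omega>" for q h k
  proof -
    obtain W A where W: "q \<in> W" "adapted_frame \<Omega> x W A"
      and WA: "\<forall>q\<in>W. A q $ 1 = F q \<and>
        (\<exists>C. focal_matrix A q C \<and> C \<noteq> 0 \<and> order 0 (focal_poly C) = 2)"
      using frame[OF q] by (elim exE conjE)
    then have AF: "A p $ 1 = F p" if "p \<in> W" for p using that by simp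
    obtain C where C: "focal_matrix A q C" "C \<noteq> 0" "order 0 (focal_poly C) = 2"
      using bspec[OF WA W(1)] by (elim exE conjE)
    note d = adapted_frame_derivatives[OF W(2,1) AF]
    note i = adapted_frame_independent[where F=F, OF W(2,1) AF[OF W(1)]]
    have g: "generator \<Omega> x q = span {x q, F q}" and oW: "open W"
      using W AF[OF W(1)] by (auto simp: adapted_frame_def)
    have inT: "p \<in> \<Omega> \<and> F p \<in> tangent_space x p" if "p \<in> W" for p
      using W(2) that AF[OF that] by (auto simp: adapted_frame_def intro: span_base)
    have T: "fd F q k \<in> tangent_space x q" for k
      by (rule derivative_on_generator_in_tangent_space[OF hyp \<xi> q d(3) oW W(1) inT g i(1)])
    note f = double_focus_facts[OF W(2,1) AF C T has_derivative_linear[OF smooth_onD(1)[OF sx q]]]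
    show ?thesis using g i f by blast
  qed
  then show "generator \<Omega> x q = span {x q, F q}" "F q \<notin> span {x q}" "x q \<notin> span {F q}"
    "\<exists>k. fd F q k \<notin> span {x q, F q}"
    "fd F q h \<in> span {x q, F q} \<Longrightarrow> fd F q k \<notin> span {x q, F q} \<Longrightarrow> fd x q h \<in> span {x q, F q, fd F q k}"
    "\<exists>h. fd F q h \<in> span {x q, F q} \<and> fd x q h \<notin> span {x q, F q}"
    if "q \<in> \<Omega>" for q h k using that by blast+
qed

subsection \<open>Submersions and curves\<close>

text \<open>The chart replaces the component of a point along \<open>h0\<close> by \<open>t\<close>,
  so fibres of \<open>t\<close> become slices of a ball by hyperplanes, which are convex. As nothing
  else is changed, the inverse \<open>\<sigma>\<close> moves in direction \<open>h0\<close> when its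
  argument does, at the speed that makes \<open>t\<close> grow at unit rate.\<close>

lemma submersion_chart:
  fixes t :: "'a::euclidean_space \<Rightarrow> real"
  assumes S: "open S" and t: "smooth_on S t" and p: "p \<in> S" and h0: "norm h0 = 1"
    and dt: "fd t p h0 \<noteq> 0"
  obtains U z0 r \<sigma> \<sigma>' where "open U" "U \<subseteq> S" "p \<in> U" "r > 0" "h0 \<bullet> z0 = t p"
    "\<And>q. q \<in> U \<Longrightarrow> \<exists>z\<in>ball z0 r. \<sigma> z = q"
    "\<And>z. z \<in> ball z0 r \<Longrightarrow> \<sigma> z \<in> U \<and> t (\<sigma> z) = h0 \<bullet> z \<and> (\<sigma> has_derivative \<sigma>' z) (at z)"
    "\<And>z k. z \<in> ball z0 r \<Longrightarrow> fd t (\<sigma> z) (\<sigma>' z k) = h0 \<bullet> k"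
    "\<And>z. z \<in> ball z0 r \<Longrightarrow> fd t (\<sigma> z) h0 \<noteq> 0 \<and> \<sigma>' z h0 = inverse (fd t (\<sigma> z) h0) *\<^sub>R h0"
    "\<And>z h. z \<in> ball z0 r \<Longrightarrow> \<exists>k. \<sigma>' z k = h"
proof -
  define \<psi> where "\<psi> q = q - (q \<bullet> h0) *\<^sub>R h0 + t q *\<^sub>R h0" for q
  define P where "P q h = h - (h \<bullet> h0) *\<^sub>R h0 + fd t q h *\<^sub>R h0" for q h
  have h00: "h0 \<bullet> h0 = 1" using h0 by (simp add: norm_eq_1)
  have d\<psi>: "(\<psi> has_derivative P q) (at q)" if "q \<in> S" for q
    unfolding \<psi>_def P_def using smooth_onD(1)[OF t that]
    by (auto intro!: derivative_eq_intros)
  have blP: "bounded_linear (P q)" if "q \<in> S" for q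
    using d\<psi>[OF that] has_derivative_bounded_linear by blast
  have inner_P: "h0 \<bullet> P q h = fd t q h" for q h
    by (simp add: P_def inner_add_right inner_diff_right h00 inner_commute)
  have inner_\<psi>: "h0 \<bullet> \<psi> q = t q" for q
    by (simp add: \<psi>_def inner_add_right inner_diff_right h00 inner_commute)
  \<comment> \<open>The inverse function theorem takes the derivative as a continuous family of
    bounded operators; in finite dimension continuity can be tested on basis vectors.\<close>
  define B where "B q = Blinfun (P q)" for q
  have B: "blinfun_apply (B q) = P q" if "q \<in> S" for q
    using bounded_linear_Blinfun_apply[OF blP[OF that]] by (simp add: B_def)
  have contB: "continuous_on S B"
  proof (rule continuous_on_blinfun_componentwise)
    fix i :: 'a assume "i \<in> Basis"
    have "continuous_on S (\<lambda>q. P q i)"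
      unfolding P_def by (intro continuous_intros smooth_onD(3)[OF smooth_onD(2)[OF t]])
    then show "continuous_on S (\<lambda>q. blinfun_apply (B q) i)"
      by (rule continuous_on_eq) (simp add: B)
  qed
  have linP: "linear (P p)" using blP[OF p] by (rule bounded_linear.linear)
  have "inj (P p)"
  proof (subst linear_injective_0[OF linP], intro allI impI)
    fix h assume 0: "P p h = 0"
    then have t0: "fd t p h = 0" using inner_P[of p h] by simp
    then have h: "h = (h \<bullet> h0) *\<^sub>R h0" using 0 by (simp add: P_def)
    have "linear (fd t p)" by (rule has_derivative_linear[OF smooth_onD(1)[OF t p]])
    from linear_cmul[OF this, of "h \<bullet> h0" h0] have "h \<bullet> h0 = 0" using t0 h dt by simp
    then show "h = 0" using h by simp
  qed
  then obtain G where G: "linear G" "G \<circ> P p = id" using linear_injective_left_inverse[OF linP] by blast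
  have blG: "bounded_linear G" using G(1) linear_conv_bounded_linear by blast
  have "Blinfun G o\<^sub>L B p = id_blinfun"
    by (rule blinfun_eqI) (use fun_cong[OF G(2)] in \<open>simp add: B[OF p] bounded_linear_Blinfun_apply[OF blG]\<close>)
  then obtain U' V \<sigma> \<sigma>' where U': "open U'" "U' \<subseteq> S" "p \<in> U'" and V: "open V" "\<psi> p \<in> V"
    and hom: "homeomorphism U' V \<psi> \<sigma>"
    and d\<sigma>: "\<And>y. y \<in> V \<Longrightarrow> (\<sigma> has_derivative \<sigma>' y) (at y)"
    and inv: "\<And>y. y \<in> V \<Longrightarrow> \<sigma>' y = inv (blinfun_apply (B (\<sigma> y)))"
    and bij: "\<And>y. y \<in> V \<Longrightarrow> bij (blinfun_apply (B (\<sigma> y)))"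
    using inverse_function_theorem[OF S, of \<psi> B p "Blinfun G"] d\<psi> B contB p by (metis (no_types, lifting))
  obtain r where r: "r > 0" "ball (\<psi> p) r \<subseteq> V" using V open_contains_ball by blast
  \<comment> \<open>Shrinks the domain so that its image under \<open>\<psi>\<close> is a
    ball.\<close>
  define U where "U = U' \<inter> \<psi> -` ball (\<psi> p) r"
  have \<sigma>V: "\<sigma> z \<in> U'" "\<psi> (\<sigma> z) = z" if "z \<in> V" for z
    using hom that by (auto simp: homeomorphism_def)
  have \<sigma>S: "\<sigma> z \<in> S" if "z \<in> V" for z using \<sigma>V(1)[OF that] U'(2) by blast
  have bijP: "bij (P (\<sigma> z))" and invP: "\<sigma>' z = Hilbert_Choice.inv (P (\<sigma> z))" if "z \<in> V" for z
    using bij[OF that] inv[OF that] B[OF \<sigma>S[OF that]] by simp_all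
  have P\<sigma>: "P (\<sigma> z) (\<sigma>' z k) = k" and \<sigma>P: "\<sigma>' z (P (\<sigma> z) h) = h" if "z \<in> V" for z k h
    using bijP[OF that] by (auto simp: invP[OF that] bij_def surj_f_inv_f)
  have Ph0: "P q h0 = fd t q h0 *\<^sub>R h0" for q by (simp add: P_def h00)
  show thesis
  proof (rule that[of U r "\<psi> p" \<sigma> \<sigma>'])
    show "open U" unfolding U_def
      by (rule continuous_open_preimage[OF homeomorphism_cont1[OF hom] U'(1) open_ball])
    show "U \<subseteq> S" "p \<in> U" "r > 0" "h0 \<bullet> \<psi> p = t p" using U' r inner_\<psi> by (auto simp: U_def)
    show "\<exists>z\<in>ball (\<psi> p) r. \<sigma> z = q" if "q \<in> U" for q
      using that hom by (intro bexI[of _ "\<psi> q"]) (auto simp: U_def homeomorphism_def)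
    fix z assume z: "z \<in> ball (\<psi> p) r"
    then have zV: "z \<in> V" using r by blast
    show "\<sigma> z \<in> U \<and> t (\<sigma> z) = h0 \<bullet> z \<and> (\<sigma> has_derivative \<sigma>' z) (at z)"
      using \<sigma>V[OF zV] d\<sigma>[OF zV] z inner_\<psi>[of "\<sigma> z"] by (simp add: U_def)
    show "fd t (\<sigma> z) (\<sigma>' z k) = h0 \<bullet> k" for k
      using inner_P[of "\<sigma> z" "\<sigma>' z k"] P\<sigma>[OF zV] by simp
    have lin: "linear (\<sigma>' z)" using d\<sigma>[OF zV] has_derivative_linear by blast
    have eq: "h0 = fd t (\<sigma> z) h0 *\<^sub>R \<sigma>' z h0"
      using \<sigma>P[OF zV, of h0] unfolding Ph0 linear_cmul[OF lin] by simp
    then have "fd t (\<sigma> z) h0 \<noteq> 0" using h0 by (metis norm_zero scaleR_zero_left zero_neq_one)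
    then show "fd t (\<sigma> z) h0 \<noteq> 0 \<and> \<sigma>' z h0 = inverse (fd t (\<sigma> z) h0) *\<^sub>R h0"
      using eq by (metis scaleR_scaleR left_inverse scaleR_one)
    show "\<exists>k. \<sigma>' z k = h" for h using \<sigma>P[OF zV] by blast
  qed
qed

section \<open>Linear maps with prescribed kernel\<close>

text \<open>Subtract the orthogonal projection to \<open>c\<close>. For \<open>c = 0\<close> the
  formula gives the identity, so \<open>kernel_pair\<close> can apply it to a vector that may
  vanish.\<close>

lemma kernel_singleton:
  fixes c :: "'a::real_inner"
  shows "\<exists>\<pi> :: 'a \<Rightarrow> 'a. bounded_linear \<pi> \<and> (\<forall>v. \<pi> v = 0 \<longleftrightarrow> v \<in> span {c})"
proof (intro exI conjI allI)
  let ?P = "\<lambda>v. v - ((v \<bullet> c) / (c \<bullet> c)) *\<^sub>R c"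
  show "bounded_linear ?P"
    by (intro bounded_linear_intros bounded_linear_sub bounded_linear_scaleR_const
        bounded_linear_compose[OF bounded_linear_divide] bounded_linear_inner_left)
  show "?P v = 0 \<longleftrightarrow> v \<in> span {c}" for v
    unfolding in_span_sing by (cases "c = 0") (auto intro: exI[of _ "(v \<bullet> c) / (c \<bullet> c)"])
qed

lemma kernel_pair:
  fixes c d :: "'a::real_inner"
  obtains \<pi> :: "'a \<Rightarrow> 'a" where "bounded_linear \<pi>" "\<And>v. \<pi> v = 0 \<longleftrightarrow> v \<in> span {c, d}"
proof -
  obtain P :: "'a \<Rightarrow> 'a" where P: "bounded_linear P" "\<And>v. P v = 0 \<longleftrightarrow> v \<in> span {c}"
    using kernel_singleton by blast
  obtain Q :: "'a \<Rightarrow> 'a" where Q: "bounded_linear Q" "\<And>v. Q v = 0 \<longleftrightarrow> v \<in> span {P d}"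
    using kernel_singleton by blast
  have "Q (P v) = 0 \<longleftrightarrow> v \<in> span {c, d}" for v
  proof -
    have "P v = r *\<^sub>R P d \<longleftrightarrow> P (v - r *\<^sub>R d) = 0" for r
      using P(1) by (simp add: linear_diff linear_cmul bounded_linear.linear)
    then show ?thesis
      unfolding Q(2) in_span_sing[of "P v"] insert_commute[of c d] span_breakdown_eq[of v d]
      by (simp add: P(2))
  qed
  then show thesis by (rule that[OF bounded_linear_compose[OF Q(1) P(1)]])
qed

lemma dual_functional:
  fixes a b d :: "'a::real_inner"
  assumes "d \<notin> span {a, b}"
  obtains n :: "'a \<Rightarrow> real" where "bounded_linear n" "n a = 0" "n b = 0" "n d = 1"
proof -
  obtain \<pi> :: "'a \<Rightarrow> 'a" where \<pi>: "bounded_linear \<pi>" "\<And>v. \<pi> v = 0 \<longleftrightarrow> v \<in> span {a, b}"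
    using kernel_pair by blast
  have ne: "\<pi> d \<noteq> 0" using \<pi>(2) assms by simp
  show thesis
  proof (rule that[of "\<lambda>v. (\<pi> v \<bullet> \<pi> d) / (\<pi> d \<bullet> \<pi> d)"])
    show "bounded_linear (\<lambda>v. (\<pi> v \<bullet> \<pi> d) / (\<pi> d \<bullet> \<pi> d))"
      by (intro bounded_linear_compose[OF bounded_linear_divide]
          bounded_linear_compose[OF bounded_linear_inner_left \<pi>(1)])
    have "\<pi> a = 0" "\<pi> b = 0" using \<pi>(2) by (auto intro: span_base)
    then show "(\<pi> a \<bullet> \<pi> d) / (\<pi> d \<bullet> \<pi> d) = 0" "(\<pi> b \<bullet> \<pi> d) / (\<pi> d \<bullet> \<pi> d) = 0"
      "(\<pi> d \<bullet> \<pi> d) / (\<pi> d \<bullet> \<pi> d) = 1" using ne by simp_all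
  qed
qed

section \<open>Functions of one real variable\<close>

lemma constant_if_derivative_zero:
  fixes u :: "real \<Rightarrow> 'a::real_inner"
  assumes "\<And>s. 0 \<le> s \<Longrightarrow> s \<le> 1 \<Longrightarrow> (u has_vector_derivative 0) (at s)"
  shows "u 1 = u 0"
proof -
  have "n \<bullet> u 1 = n \<bullet> u 0" for n
  proof (rule DERIV_isconst_end[of 0 1 "\<lambda>s. n \<bullet> u s"])
    have D: "((\<lambda>s. n \<bullet> u s) has_real_derivative 0) (at s)" if "0 \<le> s" "s \<le> 1" for s
      using bounded_linear.has_vector_derivative[OF bounded_linear_inner_right[of n] assms[OF that]]
      by (simp add: has_real_derivative_iff_has_vector_derivative)
    show "((\<lambda>s. n \<bullet> u s) has_real_derivative 0) (at s)" if "0 < s" "s < 1" for s using D that by simp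
    show "continuous_on {0..1} (\<lambda>s. n \<bullet> u s)"
      by (rule continuous_at_imp_continuous_on) (auto intro!: DERIV_isCont D)
  qed simp
  then have "\<forall>n. n \<bullet> u 1 = n \<bullet> u 0" ..
  then show ?thesis by (rule iffD1[OF vector_eq_ldot])
qed

text \<open>The coefficient \<open>a\<close> will come from pointwise choices and has no regularity,
  so there is no integrating factor. Instead the quotient (u . n)^2 / |u|^2, which does not see the
  length of \<open>u\<close>, has derivative zero; it vanishes at the start if \<open>n\<close> is
  orthogonal to \<open>u 0\<close>, hence also at the end.\<close>

lemma direction_constant:
  fixes u :: "real \<Rightarrow> 'a::real_inner"
  assumes u: "\<And>s. 0 \<le> s \<Longrightarrow> s \<le> 1 \<Longrightarrow> (u has_vector_derivative a s *\<^sub>R u s) (at s)"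
    and ne: "\<And>s. 0 \<le> s \<Longrightarrow> s \<le> 1 \<Longrightarrow> u s \<noteq> 0"
  shows "u 1 \<in> span {u 0}"
proof (rule parallel_if_orthogonal_subset)
  show "u 0 \<noteq> 0" using ne by simp
  fix n assume n: "u 0 \<bullet> n = 0"
  define \<phi> where "\<phi> s = (u s \<bullet> n) * (u s \<bullet> n) / (u s \<bullet> u s)" for s
  have "(\<phi> has_vector_derivative 0) (at s)" if s: "0 \<le> s" "s \<le> 1" for s
  proof -
    have du: "(u has_derivative (\<lambda>r. (r * a s) *\<^sub>R u s)) (at s)"
      using u[OF s] by (simp add: has_vector_derivative_def)
    have "u s \<bullet> u s \<noteq> 0" using ne[OF s] by simp
    then have "(\<phi> has_derivative (\<lambda>r. 0)) (at s)"
      unfolding \<phi>_def by (auto intro!: derivative_eq_intros du ext simp: field_simps)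
    then show ?thesis by (simp add: has_vector_derivative_def)
  qed
  then have "\<phi> 1 = \<phi> 0" by (rule constant_if_derivative_zero)
  then show "u 1 \<bullet> n = 0" using n ne[of 1] by (simp add: \<phi>_def)
qed

text \<open>The derivative is given at 0 only. It makes \<open>f\<close> take values of both signs
  arbitrarily close to 0, and the intermediate value theorem fills the gap between them.\<close>

lemma real_local_surj:
  fixes f :: "real \<Rightarrow> real"
  assumes "(f has_real_derivative d) (at 0)" "d \<noteq> 0" "f 0 = 0" "\<eta> > 0" "continuous_on {-\<eta>..\<eta>} f"
  shows "\<exists>\<epsilon>>0. \<forall>y. \<bar>y\<bar> < \<epsilon> \<longrightarrow> (\<exists>s\<in>{-\<eta>..\<eta>}. f s = y)"
proof -
  have pos: "\<exists>\<epsilon>>0. \<forall>y. \<bar>y\<bar> < \<epsilon> \<longrightarrow> (\<exists>s\<in>{-\<eta>..\<eta>}. f s = y)"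
    if f: "(f has_real_derivative d) (at 0)" "d > 0" "f 0 = 0" "continuous_on {-\<eta>..\<eta>} f" for f d
  proof -
    obtain d1 where d1: "d1 > 0" "\<forall>h>0. h < d1 \<longrightarrow> f 0 < f (0 + h)"
      using DERIV_pos_inc_right[OF f(1,2)] by blast
    obtain d2 where d2: "d2 > 0" "\<forall>h>0. h < d2 \<longrightarrow> f (0 - h) < f 0"
      using DERIV_pos_inc_left[OF f(1,2)] by blast
    define h where "h = min \<eta> (min d1 d2 / 2)"
    have h: "h > 0" "h < d1" "h < d2" "h \<le> \<eta>" using d1 d2 assms(4) by (auto simp: h_def)
    have "f h > 0" "f (- h) < 0" using d1 d2 h f(3) by fastforce+
    define \<epsilon> where "\<epsilon> = min (f h) (- f (- h))"
    have "\<exists>s\<in>{-\<eta>..\<eta>}. f s = y" if "\<bar>y\<bar> < \<epsilon>" for y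
    proof -
      have "continuous_on {-h..h} f" by (rule continuous_on_subset[OF f(4)]) (use h in auto)
      moreover have "f (- h) \<le> y" "y \<le> f h" using that by (auto simp: \<epsilon>_def)
      ultimately obtain s where "- h \<le> s" "s \<le> h" "f s = y" using IVT'[of f "- h" y h] h by auto
      then show ?thesis using h by (intro bexI[of _ s]) auto
    qed
    moreover have "\<epsilon> > 0" using \<open>f h > 0\<close> \<open>f (- h) < 0\<close> by (simp add: \<epsilon>_def)
    ultimately show ?thesis by blast
  qed
  show ?thesis
  proof (cases "d > 0")
    case True
    then show ?thesis using pos assms by blast
  next
    case False
    then have "- d > 0" using assms(2) by simp
    moreover have "((\<lambda>s. - f s) has_real_derivative - d) (at 0)" using assms(1) by (rule DERIV_minus)
    moreover have "continuous_on {-\<eta>..\<eta>} (\<lambda>s. - f s)" using assms(5) by (rule continuous_on_minus)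
    ultimately obtain \<epsilon> where e: "\<epsilon> > 0" "\<And>y. \<bar>y\<bar> < \<epsilon> \<Longrightarrow> \<exists>s\<in>{-\<eta>..\<eta>}. - f s = y"
      using pos[of "\<lambda>s. - f s" "- d"] assms(3) by auto
    have "\<exists>s\<in>{-\<eta>..\<eta>}. f s = y" if "\<bar>y\<bar> < \<epsilon>" for y
      using e(2)[of "- y"] that by auto
    then show ?thesis using e(1) by blast
  qed
qed

subsection \<open>Families of lines in a plane\<close>

lemma span_pair_replace:
  fixes a :: "'a::real_vector"
  assumes v: "v = r *\<^sub>R a + s *\<^sub>R y" and s: "s \<noteq> 0"
  shows "span {a, v} = span {y, a}"
proof (rule span_eq[THEN iffD2], intro conjI)
  show "{a, v} \<subseteq> span {y, a}" by (auto simp: v intro: span_base span_add span_scale)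
  have "y = inverse s *\<^sub>R (v - r *\<^sub>R a)" by (simp add: v s)
  then have "y \<in> span {a, v}" by (auto intro: span_base span_diff span_scale)
  then show "{y, a} \<subseteq> span {a, v}" by (auto intro: span_base)
qed

text \<open>The lines of the pencil with center \<open>a\<close> are parametrized by the ratio of the coordinates with
  respect to \<open>b\<close> and \<open>X 0\<close>, and this ratio has a nonzero derivative along \<open>X\<close>.\<close>

lemma lines_through_curve_open:
  fixes X :: "real \<Rightarrow> 'a::real_inner"
  assumes dX: "(X has_vector_derivative X') (at 0)" and \<eta>: "\<eta> > 0"
    and cont: "continuous_on {-\<eta>..\<eta>} X"
    and X: "\<And>s. s \<in> {-\<eta>..\<eta>} \<Longrightarrow> X s \<in> span {a, b, X 0}"
    and X': "X' \<in> span {a, b, X 0}" "X' \<notin> span {X 0, a}"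
    and ind: "X 0 \<notin> span {a, b}" "b \<notin> span {X 0, a}"
    and v0: "v0 = m *\<^sub>R a + l *\<^sub>R X 0" "l \<noteq> 0"
  obtains T where "open T" "v0 \<in> T"
    "\<And>v. v \<in> T \<Longrightarrow> v \<in> span {a, b, X 0} \<Longrightarrow>
       v \<notin> span {a} \<and> (\<exists>s\<in>{-\<eta>..\<eta>}. span {a, v} = span {X s, a})"
proof -
  obtain n1 :: "'a \<Rightarrow> real" where n1: "bounded_linear n1" "n1 (X 0) = 0" "n1 a = 0" "n1 b = 1"
    using dual_functional[OF ind(2)] by blast
  obtain n2 :: "'a \<Rightarrow> real" where n2: "bounded_linear n2" "n2 a = 0" "n2 b = 0" "n2 (X 0) = 1"
    using dual_functional[OF ind(1)] by blast
  note lin1 = bounded_linear.linear[OF n1(1)] and lin2 = bounded_linear.linear[OF n2(1)]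
  have n1c: "n1 (r *\<^sub>R a + s *\<^sub>R b + t *\<^sub>R X 0) = s" and n2c: "n2 (r *\<^sub>R a + s *\<^sub>R b + t *\<^sub>R X 0) = t"
    for r s t
    using n1 n2 by (simp_all add: linear_add[OF lin1] linear_cmul[OF lin1] linear_add[OF lin2] linear_cmul[OF lin2])
  obtain \<alpha> \<beta> \<gamma> where abc: "X' = \<alpha> *\<^sub>R a + \<beta> *\<^sub>R b + \<gamma> *\<^sub>R X 0" using X'(1) unfolding in_span_triple by blast
  \<comment> \<open>This is where the curve of lines is seen to turn inside the plane: without a
    component along \<open>b\<close>, the velocity would stay in the line itself.\<close>
  have \<beta>: "\<beta> \<noteq> 0"
  proof
    assume "\<beta> = 0"
    then have "X' \<in> span {X 0, a}" unfolding abc by (auto intro: span_add span_scale span_base)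
    then show False using X'(2) by simp
  qed
  have d1: "((\<lambda>s. n1 (X s)) has_real_derivative \<beta>) (at 0)"
    using bounded_linear.has_vector_derivative[OF n1(1) dX]
    by (simp add: has_real_derivative_iff_has_vector_derivative abc n1c)
  have d2: "((\<lambda>s. n2 (X s)) has_real_derivative \<gamma>) (at 0)"
    using bounded_linear.has_vector_derivative[OF n2(1) dX]
    by (simp add: has_real_derivative_iff_has_vector_derivative abc n2c)
  have "isCont (\<lambda>s. n2 (X s)) 0" using d2 by (rule DERIV_isCont)
  then obtain \<delta> where \<delta>: "\<delta> > 0" "\<And>s. \<bar>s\<bar> < \<delta> \<Longrightarrow> \<bar>n2 (X s) - 1\<bar> < 1"
    unfolding continuous_at_eps_delta dist_real_def using n2(4) by (metis diff_zero zero_less_one)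
  \<comment> \<open>Half of \<open>\<delta>\<close>, since the interval of radius
    \<open>\<kappa>\<close> is closed and the bound holds for strict inequality.\<close>
  define \<kappa> where "\<kappa> = min \<eta> (\<delta> / 2)"
  have \<kappa>: "\<kappa> > 0" "{-\<kappa>..\<kappa>} \<subseteq> {-\<eta>..\<eta>}" using \<eta> \<delta>(1) by (auto simp: \<kappa>_def)
  have pos: "n2 (X s) > 0" if "s \<in> {-\<kappa>..\<kappa>}" for s
  proof -
    have "\<bar>s\<bar> \<le> \<kappa>" using that by auto
    then have "\<bar>s\<bar> < \<delta>" using \<delta>(1) by (simp add: \<kappa>_def)
    from \<delta>(2)[OF this] show ?thesis by arith
  qed
  define \<rho> where "\<rho> s = n1 (X s) / n2 (X s)" for s
  have "(\<rho> has_real_derivative \<beta>) (at 0)"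
    unfolding \<rho>_def using DERIV_divide[OF d1 d2] by (simp add: n1 n2)
  moreover have "\<rho> 0 = 0" by (simp add: \<rho>_def n1)
  moreover have "continuous_on {-\<kappa>..\<kappa>} \<rho>"
    unfolding \<rho>_def
  proof (intro continuous_on_divide ballI)
    have c: "continuous_on {-\<kappa>..\<kappa>} X" by (rule continuous_on_subset[OF cont \<kappa>(2)])
    show "continuous_on {-\<kappa>..\<kappa>} (\<lambda>s. n1 (X s))" "continuous_on {-\<kappa>..\<kappa>} (\<lambda>s. n2 (X s))"
      by (rule bounded_linear.continuous_on[OF n1(1) c], rule bounded_linear.continuous_on[OF n2(1) c])
    show "n2 (X s) \<noteq> 0" if "s \<in> {-\<kappa>..\<kappa>}" for s using pos[OF that] by simp
  qed
  ultimately obtain \<epsilon> where \<epsilon>: "\<epsilon> > 0" "\<And>y. \<bar>y\<bar> < \<epsilon> \<Longrightarrow> \<exists>s\<in>{-\<kappa>..\<kappa>}. \<rho> s = y"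
    using real_local_surj[OF _ \<beta> _ \<kappa>(1)] by blast
  \<comment> \<open>Vectors whose coordinate ratio is below \<open>\<epsilon>\<close> in absolute
    value. Written without division, the strict inequality also forces \<open>n2 v\<close> to be
    nonzero, which keeps \<open>v\<close> off the center.\<close>
  define T where "T = {v. \<bar>n1 v\<bar> < \<epsilon> * \<bar>n2 v\<bar>}"
  show thesis
  proof (rule that[of T])
    have c: "continuous_on UNIV n1" "continuous_on UNIV n2"
      using n1(1) n2(1) by (simp_all add: linear_continuous_on)
    show "open T" unfolding T_def
      by (intro open_Collect_less continuous_intros c)
    have "v0 = m *\<^sub>R a + 0 *\<^sub>R b + l *\<^sub>R X 0" by (simp add: v0)
    then have "n1 v0 = 0" "n2 v0 = l" using n1c n2c by metis+
    then show "v0 \<in> T" using v0(2) \<epsilon>(1) by (simp add: T_def)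
    fix v assume v: "v \<in> T" "v \<in> span {a, b, X 0}"
    obtain p q r where pqr: "v = p *\<^sub>R a + q *\<^sub>R b + r *\<^sub>R X 0" using v(2) unfolding in_span_triple by blast
    have q: "\<bar>q\<bar> < \<epsilon> * \<bar>r\<bar>" using v(1) by (simp add: T_def pqr n1c n2c)
    then have r: "r \<noteq> 0" using \<epsilon>(1) by auto
    have "v \<notin> span {a}"
    proof
      assume "v \<in> span {a}"
      then have "n2 v = 0" unfolding in_span_sing by (auto simp: linear_cmul[OF lin2] n2)
      then show False using r by (simp add: pqr n2c)
    qed
    moreover have "\<bar>q / r\<bar> < \<epsilon>" using q r by (simp add: abs_divide divide_less_eq)
    then obtain s where s: "s \<in> {-\<kappa>..\<kappa>}" "\<rho> s = q / r" using \<epsilon>(2) by blast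
    obtain p' q' r' where pqr': "X s = p' *\<^sub>R a + q' *\<^sub>R b + r' *\<^sub>R X 0"
      using X s(1) \<kappa>(2) in_span_triple by (metis subset_iff)
    have n1s: "n1 (X s) = q'" and n2s: "n2 (X s) = r'" using pqr' n1c n2c by metis+
    have r': "r' \<noteq> 0" using pos[OF s(1)] n2s by simp
    have qr: "q = r / r' * q'" using s(2) r r' by (simp add: \<rho>_def n1s n2s field_simps)
    \<comment> \<open>\<open>X s\<close> and \<open>v\<close> have equal ratios, so after rescaling
      they differ only by a multiple of \<open>a\<close> and span the same line with it.\<close>
    have "(r / r') *\<^sub>R X s = (r / r' * p') *\<^sub>R a + q *\<^sub>R b + r *\<^sub>R X 0"
      using r' unfolding pqr' qr by (simp add: scaleR_add_right)
    then have "v = (p - r / r' * p') *\<^sub>R a + (r / r') *\<^sub>R X s"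
      by (simp add: pqr scaleR_diff_left)
    then have "span {a, v} = span {X s, a}" by (rule span_pair_replace) (use r r' in simp)
    ultimately show "v \<notin> span {a} \<and> (\<exists>s\<in>{-\<eta>..\<eta>}. span {a, v} = span {X s, a})"
      using s(1) \<kappa>(2) by blast
  qed
qed

subsection \<open>The foliation of a twisted cone\<close>

text \<open>The functional given by \<open>F p\<close> equals 1 on the normalised focus
  \<open>f\<close>, so it annihilates every derivative of \<open>f\<close>. Hence no multiple of
  \<open>F\<close> can occur in them, and projective rank one becomes the factorisation of
  \<open>df\<close> into \<open>dt\<close> and one vector field \<open>E\<close>.\<close>

lemma twisted_cone_coordinate:
  assumes tc: "twisted_cone \<Omega> x F" and p: "p \<in> \<Omega>"
  obtains S t f E e e' h0 where "open S" "S \<subseteq> \<Omega>" "p \<in> S" "smooth_on S x" "smooth_on S t"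
    "smooth_on S f" "smooth_on S E" "norm h0 = 1" "\<And>q. q \<in> S \<Longrightarrow> fd t q h0 \<noteq> 0"
    "\<And>q. q \<in> S \<Longrightarrow> span {F q} = span {f q} \<and> generator \<Omega> x q = span {x q, f q}"
    "\<And>q. q \<in> S \<Longrightarrow> e \<bullet> f q = 1 \<and> e' \<bullet> f q = t q"
    "\<And>q h. q \<in> S \<Longrightarrow> fd f q h = fd t q h *\<^sub>R E q"
    "\<And>q. q \<in> S \<Longrightarrow> E q \<notin> span {x q, f q} \<and> x q \<notin> span {f q}"
    "\<And>q h. q \<in> S \<Longrightarrow> fd t q h = 0 \<Longrightarrow> fd x q h \<in> span {x q, f q, E q}"
    "\<And>q. q \<in> S \<Longrightarrow> \<exists>h. fd t q h = 0 \<and> fd x q h \<notin> span {x q, f q}"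
proof -
  note tcf = twisted_cone_facts[OF tc]
  define l where "l q = F p \<bullet> F q" for q
  define S1 where "S1 = {q \<in> \<Omega>. l q \<noteq> 0}"
  have sl: "smooth_on \<Omega> l" unfolding l_def
    by (rule smooth_on_linear[OF bounded_linear_inner_right tcf(1,3)])
  have "open (\<Omega> \<inter> l -` (- {0}))"
    by (rule continuous_open_preimage[OF smooth_onD(3)[OF sl] tcf(1)]) auto
  moreover have "S1 = \<Omega> \<inter> l -` (- {0})" by (auto simp: S1_def)
  ultimately have oS1: "open S1" by simp
  have "F p \<noteq> 0" using tcf(5)[OF p] by (metis span_zero)
  then have pS1: "p \<in> S1" using p by (simp add: S1_def l_def)
  have sub: "S1 \<subseteq> \<Omega>" and l0: "\<And>q. q \<in> S1 \<Longrightarrow> l q \<noteq> 0" by (auto simp: S1_def)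
  define f where "f q = inverse (l q) *\<^sub>R F q" for q
  have sf: "smooth_on S1 f" unfolding f_def
    by (intro smooth_on_bilinear[OF bounded_bilinear_scaleR oS1] smooth_on_inverse[OF oS1] l0
        smooth_on_subset[OF sl sub] smooth_on_subset[OF tcf(3) sub])
  have Ff: "F q = l q *\<^sub>R f q" if "q \<in> S1" for q using l0[OF that] by (simp add: f_def)
  have dF: "fd F q h = l q *\<^sub>R fd f q h + fd l q h *\<^sub>R f q" if q: "q \<in> S1" for q h
  proof -
    have "((\<lambda>q. l q *\<^sub>R f q) has_derivative (\<lambda>h. l q *\<^sub>R fd f q h + fd l q h *\<^sub>R f q)) (at q)"
      using has_derivative_scaleR[OF smooth_onD(1)[OF smooth_on_subset[OF sl sub] q] smooth_onD(1)[OF sf q]] .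
    from has_derivative_transform_within_open[OF this oS1 q] Ff
    have "(F has_derivative (\<lambda>h. l q *\<^sub>R fd f q h + fd l q h *\<^sub>R f q)) (at q)" by simp
    then show ?thesis by (simp add: fd_eqI)
  qed
  have ef: "F p \<bullet> f q = 1" if "q \<in> S1" for q using l0[OF that] by (simp add: f_def l_def)
  have edf: "F p \<bullet> fd f q h = 0" if q: "q \<in> S1" for q h
  proof -
    have "((\<lambda>q. F p \<bullet> f q) has_derivative (\<lambda>h. F p \<bullet> fd f q h)) (at q)"
      by (rule bounded_linear.has_derivative[OF bounded_linear_inner_right smooth_onD(1)[OF sf q]])
    moreover have "((\<lambda>q. F p \<bullet> f q) has_derivative (\<lambda>h. 0)) (at q)"
      by (rule has_derivative_transform_within_open[OF has_derivative_const oS1 q]) (simp add: ef)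
    ultimately have "(\<lambda>h. F p \<bullet> fd f q h) = (\<lambda>h. 0)" by (rule has_derivative_unique)
    from fun_cong[OF this, of h] show ?thesis .
  qed
  have spanF: "span {x q, F q} = span {x q, f q}" "span {F q} = span {f q}" if "q \<in> S1" for q
  proof -
    have "f q = inverse (l q) *\<^sub>R F q" by (simp add: f_def)
    then have "f q \<in> span {x q, F q}" "f q \<in> span {F q}" by (metis insertI1 insertI2 span_base span_scale)+
    moreover have "F q \<in> span {x q, f q}" "F q \<in> span {f q}"
      using Ff[OF that] by (metis insertI1 insertI2 span_base span_scale)+
    ultimately show "span {x q, F q} = span {x q, f q}" "span {F q} = span {f q}"
      by (auto simp: span_eq intro: span_base)
  qed
  have dFf: "fd F q h \<in> span {x q, f q} \<longleftrightarrow> fd f q h \<in> span {x q, f q}" if q: "q \<in> S1" for q h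
  proof
    assume "fd F q h \<in> span {x q, f q}"
    then have "inverse (l q) *\<^sub>R (fd F q h - fd l q h *\<^sub>R f q) \<in> span {x q, f q}"
      by (auto intro: span_scale span_diff span_base)
    then show "fd f q h \<in> span {x q, f q}" using l0[OF q] by (simp add: dF[OF q])
  next
    assume "fd f q h \<in> span {x q, f q}"
    then show "fd F q h \<in> span {x q, f q}" unfolding dF[OF q] by (auto intro: span_scale span_add span_base)
  qed
  obtain k0 where "fd F p k0 \<notin> span {x p, F p}" using tcf(8)[OF p] by blast
  then have "fd f p k0 \<notin> span {x p, f p}" using dFf[OF pS1] spanF(1)[OF pS1] by simp
  then have k0: "fd f p k0 \<noteq> 0" by (metis span_zero)
  \<comment> \<open>With this choice \<open>dt(k0)\<close> at \<open>p\<close> is the squared norm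
    of \<open>e'\<close>, hence nonzero.\<close>
  define e' where "e' = fd f p k0"
  define t where "t q = e' \<bullet> f q" for q
  have st: "smooth_on S1 t" unfolding t_def by (rule smooth_on_linear[OF bounded_linear_inner_right oS1 sf])
  have dt: "fd t q h = e' \<bullet> fd f q h" if q: "q \<in> S1" for q h
    unfolding t_def
    using fd_eqI[OF bounded_linear.has_derivative[OF bounded_linear_inner_right smooth_onD(1)[OF sf q]]] by simp
  have lin: "linear (fd f q)" if "q \<in> S1" for q using has_derivative_linear[OF smooth_onD(1)[OF sf that]] .
  define h0 where "h0 = k0 /\<^sub>R norm k0"
  have k00: "k0 \<noteq> 0" using k0 linear_0[OF lin[OF pS1]] by metis
  have "fd t p h0 \<noteq> 0" unfolding dt[OF pS1] h0_def using k0 k00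
    by (simp add: linear_cmul[OF lin[OF pS1]] e'_def)
  \<comment> \<open>The direction \<open>h0\<close> stays transversal to the fibres of
    \<open>t\<close> at every point of \<open>S\<close>, so one fixed direction serves as
    transversal and normalises \<open>E\<close>.\<close>
  define S where "S = {q \<in> S1. fd t q h0 \<noteq> 0}"
  have "open (S1 \<inter> (\<lambda>q. fd t q h0) -` (- {0}))"
    by (rule continuous_open_preimage[OF smooth_onD(3)[OF smooth_onD(2)[OF st]] oS1]) auto
  moreover have "S = S1 \<inter> (\<lambda>q. fd t q h0) -` (- {0})" by (auto simp: S_def)
  ultimately have oS: "open S" by simp
  have SS1: "S \<subseteq> S1" and w0: "\<And>q. q \<in> S \<Longrightarrow> fd t q h0 \<noteq> 0" by (auto simp: S_def)
  define E where "E q = inverse (fd t q h0) *\<^sub>R fd f q h0" for q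
  have rank: "fd f q h = fd t q h *\<^sub>R E q" if q: "q \<in> S" for q h
  proof -
    have q1: "q \<in> S1" using q SS1 by blast
    have F0: "F q \<noteq> 0" using tcf(5)[of q] q1 sub by (metis span_zero subset_iff)
    have dfT: "fd f q h \<in> tangent_space F q" for h
    proof -
      have "fd F q h \<in> tangent_space F q" "F q \<in> tangent_space F q"
        by (auto simp: tangent_space_def intro: span_base)
      then have "inverse (l q) *\<^sub>R (fd F q h - (fd l q h * inverse (l q)) *\<^sub>R F q) \<in> tangent_space F q"
        unfolding tangent_space_def by (intro span_scale span_diff)
      moreover have "inverse (l q) *\<^sub>R (fd F q h - (fd l q h * inverse (l q)) *\<^sub>R F q) = fd f q h"
        unfolding dF[OF q1] Ff[OF q1] scaleR_scaleR mult.assoc left_inverse[OF l0[OF q1]]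
        using l0[OF q1] by simp
      ultimately show ?thesis by simp
    qed
    have "fd f q h0 \<notin> span {F q}"
    proof
      assume "fd f q h0 \<in> span {F q}"
      then obtain r where r: "fd f q h0 = r *\<^sub>R F q" unfolding in_span_sing by blast
      have "r * l q = 0" using edf[OF q1, of h0] by (simp add: r l_def)
      then have "fd f q h0 = 0" using l0[OF q1] r by simp
      then show False using w0[OF q] dt[OF q1] by simp
    qed
    from dim_span_pair[OF F0 this] have "dim (span {F q, fd f q h0}) = 2" .
    moreover have "dim (tangent_space F q) = 2"
      using tcf(7)[of q] q1 sub unfolding proj_rank_def by force
    moreover have "{F q, fd f q h0} \<subseteq> tangent_space F q"
      using dfT[of h0] by (simp add: tangent_space_def span_base)
    then have "span {F q, fd f q h0} \<subseteq> tangent_space F q"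
      by (rule span_minimal) (simp add: tangent_space_def)
    \<comment> \<open>Both spaces have dimension 2. So \<open>df(h)\<close> is a combination of
      \<open>F q\<close> and \<open>df(h0)\<close>, and pairing with \<open>F p\<close> removes the
      first term.\<close>
    ultimately have "span {F q, fd f q h0} = tangent_space F q"
      by (intro subspace_dim_equal) (auto simp: tangent_space_def)
    then obtain a b where ab: "fd f q h = a *\<^sub>R F q + b *\<^sub>R fd f q h0"
      using dfT in_span_pair by metis
    have "a * l q = 0" using edf[OF q1, of h] edf[OF q1, of h0] by (simp add: ab inner_add_right l_def)
    then have a: "a = 0" using l0[OF q1] by simp
    have "fd t q h = b * fd t q h0" by (simp add: dt[OF q1] ab a)
    then show ?thesis using w0[OF q] by (simp add: ab a E_def)
  qed
  show thesis
  proof (rule that[of S t f E h0 "F p" e'])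
    show "open S" "S \<subseteq> \<Omega>" using oS SS1 sub by auto
    show "p \<in> S" using pS1 \<open>fd t p h0 \<noteq> 0\<close> by (simp add: S_def)
    show "smooth_on S x" "smooth_on S t" "smooth_on S f"
      using smooth_on_subset tcf(2) st sf SS1 sub by (meson subset_trans)+
    show "smooth_on S E" unfolding E_def
      by (intro smooth_on_bilinear[OF bounded_bilinear_scaleR oS] smooth_on_inverse[OF oS] w0
          smooth_on_subset[OF smooth_onD(2)[OF st] SS1] smooth_on_subset[OF smooth_onD(2)[OF sf] SS1])
    show "norm h0 = 1" using k00 by (simp add: h0_def)
    fix q assume q: "q \<in> S"
    then have q1: "q \<in> S1" and qO: "q \<in> \<Omega>" using SS1 sub by auto
    show "fd t q h0 \<noteq> 0" by (rule w0[OF q])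
    show "span {F q} = span {f q} \<and> generator \<Omega> x q = span {x q, f q}"
      using spanF[OF q1] tcf(4)[OF qO] by simp
    show "F p \<bullet> f q = 1 \<and> e' \<bullet> f q = t q" using ef[OF q1] by (simp add: t_def)
    show "fd f q h = fd t q h *\<^sub>R E q" for h by (rule rank[OF q])
    obtain k where k: "fd F q k \<notin> span {x q, F q}" using tcf(8)[OF qO] by blast
    then have "fd f q k \<notin> span {x q, f q}" using dFf[OF q1] spanF(1)[OF q1] by simp
    then have E: "E q \<notin> span {x q, f q}" unfolding rank[OF q] by (metis span_scale)
    then show "E q \<notin> span {x q, f q} \<and> x q \<notin> span {f q}"
      using tcf(6)[OF qO] spanF(2)[OF q1] by simp
    show "fd x q h \<in> span {x q, f q, E q}" if "fd t q h = 0" for h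
    proof -
      have "fd f q h \<in> span {x q, f q}" using rank[OF q, of h] that by (simp add: span_zero)
      then have "fd F q h \<in> span {x q, F q}" using dFf[OF q1] spanF(1)[OF q1] by simp
      from tcf(9)[OF qO this k] have "fd x q h \<in> span {x q, F q, fd F q k}" .
      moreover have "fd F q k = (l q * fd t q k) *\<^sub>R E q + fd l q k *\<^sub>R f q"
        by (simp add: dF[OF q1] rank[OF q])
      then have "{x q, F q, fd F q k} \<subseteq> span {x q, f q, E q}"
        using Ff[OF q1] by (auto intro: span_base span_add span_scale)
      ultimately show ?thesis using span_minimal[OF _ subspace_span] by blast
    qed
    obtain h where h: "fd F q h \<in> span {x q, F q}" "fd x q h \<notin> span {x q, F q}"
      using tcf(10)[OF qO] by blast
    then have "fd t q h *\<^sub>R E q \<in> span {x q, f q}"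
      using dFf[OF q1, of h] spanF(1)[OF q1] rank[OF q] by simp
    \<comment> \<open>\<open>E q\<close> is outside the generator, so a multiple of it lies inside
      only if the factor is zero.\<close>
    then have "fd t q h = 0" using E by (metis span_scale scaleR_scaleR left_inverse scaleR_one)
    then show "\<exists>h. fd t q h = 0 \<and> fd x q h \<notin> span {x q, f q}" using h(2) spanF(1)[OF q1] by auto
  qed
qed

theorem theorem3:
  fixes \<Omega> :: "(real^3) set" and x F :: "real^3 \<Rightarrow> real^5"
  assumes "twisted_cone \<Omega> x F" and "p\<^sub>0 \<in> \<Omega>"
  shows "\<exists>(W :: (real^3) set) (J :: real set) (t :: real^3 \<Rightarrow> real)
            (g :: real \<Rightarrow> real^5) (\<gamma> :: real \<Rightarrow> (real^5) set).
           open W \<and> p\<^sub>0 \<in> W \<and> W \<subseteq> \<Omega> \<and> open J \<and> is_interval J \<and>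
           smooth_on W t \<and> t ` W = J \<and>
           (\<forall>p\<in>W. frechet_derivative t (at p) \<noteq> (\<lambda>h. 0)) \<and>
           smooth_on J g \<and> (\<forall>s\<in>J. g s \<noteq> 0 \<and> proj_rank g s = 1) \<and>
           inj_on (\<lambda>s. span {g s}) J \<and>
           (\<forall>p\<in>W. span {F p} = span {g (t p)}) \<and>
           smooth_plane_family J \<gamma> \<and>
           (\<forall>s\<in>J. tangent_space g s \<subseteq> \<gamma> s \<and>
              open_part_of_pencil {generator \<Omega> x p | p. p \<in> W \<and> t p = s} (g s) (\<gamma> s))"
proof -
  obtain S t f E e e' h0 where S: "open S" "S \<subseteq> \<Omega>" "p\<^sub>0 \<in> S"
    and sm: "smooth_on S x" "smooth_on S t" "smooth_on S f" "smooth_on S E"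
    and h0: "norm h0 = 1" and dt0: "\<And>q. q \<in> S \<Longrightarrow> fd t q h0 \<noteq> 0"
    and gen: "\<And>q. q \<in> S \<Longrightarrow> span {F q} = span {f q} \<and> generator \<Omega> x q = span {x q, f q}"
    and e: "\<And>q. q \<in> S \<Longrightarrow> e \<bullet> f q = 1 \<and> e' \<bullet> f q = t q"
    and df: "\<And>q h. q \<in> S \<Longrightarrow> fd f q h = fd t q h *\<^sub>R E q"
    and E: "\<And>q. q \<in> S \<Longrightarrow> E q \<notin> span {x q, f q} \<and> x q \<notin> span {f q}"
    and dx: "\<And>q h. q \<in> S \<Longrightarrow> fd t q h = 0 \<Longrightarrow> fd x q h \<in> span {x q, f q, E q}"
    and tr: "\<And>q. q \<in> S \<Longrightarrow> \<exists>h. fd t q h = 0 \<and> fd x q h \<notin> span {x q, f q}"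
    by (rule twisted_cone_coordinate[OF assms]) (rule that, assumption+)
  obtain U z0 r \<sigma> \<sigma>' where U: "open U" "U \<subseteq> S" "p\<^sub>0 \<in> U" and r: "r > 0" and z0: "h0 \<bullet> z0 = t p\<^sub>0"
    and \<sigma>U: "\<And>q. q \<in> U \<Longrightarrow> \<exists>z\<in>ball z0 r. \<sigma> z = q"
    and \<sigma>: "\<And>z. z \<in> ball z0 r \<Longrightarrow> \<sigma> z \<in> U \<and> t (\<sigma> z) = h0 \<bullet> z \<and> (\<sigma> has_derivative \<sigma>' z) (at z)"
    and t\<sigma>: "\<And>z k. z \<in> ball z0 r \<Longrightarrow> fd t (\<sigma> z) (\<sigma>' z k) = h0 \<bullet> k"
    and \<sigma>h0: "\<And>z. z \<in> ball z0 r \<Longrightarrow> fd t (\<sigma> z) h0 \<noteq> 0 \<and> \<sigma>' z h0 = inverse (fd t (\<sigma> z) h0) *\<^sub>R h0"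
    and \<sigma>'surj: "\<And>z h. z \<in> ball z0 r \<Longrightarrow> \<exists>k. \<sigma>' z k = h"
    by (rule submersion_chart[OF S(1) sm(2) S(3) h0 dt0[OF S(3)]]) (rule that, assumption+)
  have h00: "h0 \<bullet> h0 = 1" using h0 by (simp add: norm_eq_1)
  \<comment> \<open>The range of the functional \<open>h0\<close> on the ball, as \<open>h0\<close>
    is a unit vector. The diameter \<open>z1\<close> in direction \<open>h0\<close> meets every
    slice once, and its image \<open>c\<close> is a transversal to the fibres.\<close>
  define J where "J = {t p\<^sub>0 - r<..<t p\<^sub>0 + r}"
  define z1 where "z1 s = z0 + (s - t p\<^sub>0) *\<^sub>R h0" for s
  define c where "c s = \<sigma> (z1 s)" for s
  have z1: "z1 s \<in> ball z0 r" "h0 \<bullet> z1 s = s" if "s \<in> J" for s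
    using that h0 by (auto simp: z1_def J_def dist_norm inner_add_right z0 h00)
  have J: "h0 \<bullet> z \<in> J" if "z \<in> ball z0 r" for z
  proof -
    have "\<bar>h0 \<bullet> (z - z0)\<bar> \<le> norm h0 * norm (z - z0)" by (rule Cauchy_Schwarz_ineq2)
    also have "\<dots> < r" using that h0 by (simp add: dist_norm norm_minus_commute)
    finally show ?thesis by (auto simp: J_def inner_diff_right z0 abs_less_iff)
  qed
  have cU: "c s \<in> U" "c s \<in> S" if "s \<in> J" for s using \<sigma>[OF z1(1)[OF that]] U(2) by (auto simp: c_def)
  have tJ: "t p \<in> J" if "p \<in> U" for p
    using \<sigma>U[OF that] \<sigma> J by metis
  have oJ: "open J" by (simp add: J_def)
  \<comment> \<open>The velocity has the form of an integral curve, so smooth fields on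
    \<open>S\<close> restrict to smooth functions on \<open>J\<close>.\<close>
  have dc: "(c has_derivative (\<lambda>r. (r * inverse (fd t (c s) h0)) *\<^sub>R h0)) (at s)" if s: "s \<in> J" for s
  proof -
    have d: "(\<sigma> has_derivative \<sigma>' (z1 s)) (at (z1 s))" using \<sigma>[OF z1(1)[OF s]] by blast
    have "(z1 has_derivative (\<lambda>r. r *\<^sub>R h0)) (at s)"
      unfolding z1_def by (auto intro!: derivative_eq_intros)
    from has_derivative_compose[OF this d]
    show ?thesis
      unfolding c_def using \<sigma>h0[OF z1(1)[OF s]]
      by (simp add: linear_cmul[OF has_derivative_linear[OF d]])
  qed
  have curve: "smooth_on J (\<lambda>s. \<phi> (c s))" if "smooth_on S \<phi>" for \<phi> :: "real^3 \<Rightarrow> real^5"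
  proof -
    have "smooth_on S (\<lambda>q. inverse (fd t q h0))"
      by (rule smooth_on_inverse[OF S(1) smooth_onD(2)[OF sm(2)] dt0])
    then have w: "diff_on k S (\<lambda>q. inverse (fd t q h0))" for k by (simp add: smooth_on_def)
    show ?thesis unfolding smooth_on_def
    proof
      fix k
      have "diff_on k S \<phi>" using that by (simp add: smooth_on_def)
      from diff_on_curve[OF S(1) oJ cU(2) dc w this] show "diff_on k J (\<lambda>s. \<phi> (c s))" .
    qed
  qed
  define g where "g s = f (c s)" for s
  define g' where "g' s = E (c s)" for s
  define y where "y s = x (c s)" for s
  define \<gamma> where "\<gamma> s = span {g s, g' s, y s}" for s
  \<comment> \<open>\<open>t\<close> has unit speed along \<open>c\<close>, so the restriction of
    \<open>E\<close> is exactly the derivative of \<open>g\<close>.\<close>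
  have dg: "(g has_derivative (\<lambda>r. r *\<^sub>R g' s)) (at s)" if s: "s \<in> J" for s
    using has_derivative_compose[OF dc[OF s] smooth_onD(1)[OF sm(3) cU(2)[OF s]]]
    by (simp add: g_def[abs_def] g'_def df[OF cU(2)[OF s]] linear_cmul[OF has_derivative_linear[OF smooth_onD(1)[OF sm(2) cU(2)[OF s]]]]
        dt0[OF cU(2)[OF s]] mult.assoc)
  have xind: "x q \<notin> span {f q, E q}" if "q \<in> S" for q
  proof
    assume "x q \<in> span {f q, E q}"
    then obtain a b where ab: "x q = a *\<^sub>R f q + b *\<^sub>R E q" unfolding in_span_pair by blast
    show False
    proof (cases "b = 0")
      case True
      then show False using ab E[OF that] by (auto simp: in_span_sing)
    next
      case False
      then have "E q = inverse b *\<^sub>R (x q - a *\<^sub>R f q)" by (simp add: ab)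
      then have "E q \<in> span {x q, f q}" by (auto intro: span_scale span_diff span_base)
      then show False using E[OF that] by blast
    qed
  qed

  \<comment> \<open>The segment from the transversal to \<open>z\<close> stays in the ball by
    convexity and in the slice of \<open>z\<close> because both ends do.\<close>
  have seg: "z1 s + \<theta> *\<^sub>R (z - z1 s) \<in> ball z0 r" "h0 \<bullet> (z1 s + \<theta> *\<^sub>R (z - z1 s)) = s" "s \<in> J"
    if z: "z \<in> ball z0 r" and s: "s = h0 \<bullet> z" and \<theta>: "0 \<le> \<theta>" "\<theta> \<le> 1" for z s \<theta>
  proof -
    show sJ: "s \<in> J" using J[OF z] s by simp
    have "(1 - \<theta>) *\<^sub>R z1 s + \<theta> *\<^sub>R z \<in> ball z0 r"
      using convex_ball[of z0 r] z1(1)[OF sJ] z \<theta> unfolding convex_alt by blast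
    then show "z1 s + \<theta> *\<^sub>R (z - z1 s) \<in> ball z0 r" by (simp add: algebra_simps)
    show "h0 \<bullet> (z1 s + \<theta> *\<^sub>R (z - z1 s)) = s"
      using z1(2)[OF sJ] s by (simp add: inner_add_right inner_diff_right)
  qed
  have segd: "((\<lambda>\<theta>. \<phi> (\<sigma> (a + \<theta> *\<^sub>R k))) has_vector_derivative fd \<phi> (\<sigma> (a + \<theta> *\<^sub>R k)) (\<sigma>' (a + \<theta> *\<^sub>R k) k)) (at \<theta>)"
    if s: "smooth_on S \<phi>" and z: "a + \<theta> *\<^sub>R k \<in> ball z0 r" for \<phi> :: "real^3 \<Rightarrow> real^5" and a k \<theta>
  proof -
    have 1: "((\<lambda>\<theta>. a + \<theta> *\<^sub>R k) has_derivative (\<lambda>r. r *\<^sub>R k)) (at \<theta>)"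
      by (auto intro!: derivative_eq_intros)
    have 2: "(\<sigma> has_derivative \<sigma>' (a + \<theta> *\<^sub>R k)) (at (a + \<theta> *\<^sub>R k))" using \<sigma>[OF z] by blast
    have 3: "(\<phi> has_derivative fd \<phi> (\<sigma> (a + \<theta> *\<^sub>R k))) (at (\<sigma> (a + \<theta> *\<^sub>R k)))"
      using smooth_onD(1)[OF s] \<sigma>[OF z] U(2) by blast
    show ?thesis
      using has_derivative_compose[OF has_derivative_compose[OF 1 2] 3]
      by (simp add: has_vector_derivative_def linear_cmul[OF has_derivative_linear[OF 2]]
          linear_cmul[OF has_derivative_linear[OF 3]])
  qed
  have f\<sigma>: "f (\<sigma> z) = g (h0 \<bullet> z)" if z: "z \<in> ball z0 r" for z
  proof -
    define s where "s = h0 \<bullet> z"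
    have "f (\<sigma> (z1 s + 1 *\<^sub>R (z - z1 s))) = f (\<sigma> (z1 s + 0 *\<^sub>R (z - z1 s)))"
    proof (rule constant_if_derivative_zero)
      fix \<theta> :: real assume \<theta>: "0 \<le> \<theta>" "\<theta> \<le> 1"
      note sg = seg[OF z s_def \<theta>]
      have q: "\<sigma> (z1 s + \<theta> *\<^sub>R (z - z1 s)) \<in> S" using \<sigma>[OF sg(1)] U(2) by blast
      have "h0 \<bullet> (z - z1 s) = 0" using z1(2)[OF sg(3)] by (simp add: inner_diff_right s_def)
      then show "((\<lambda>\<theta>. f (\<sigma> (z1 s + \<theta> *\<^sub>R (z - z1 s)))) has_vector_derivative 0) (at \<theta>)"
        using segd[OF sm(3) sg(1)] by (simp add: df[OF q] t\<sigma>[OF sg(1)])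
    qed
    then show ?thesis by (simp add: g_def c_def s_def)
  qed
  \<comment> \<open>Compare the derivatives in direction \<open>h0\<close> of the two expressions
    for the focus in the chart.\<close>
  have E\<sigma>: "E (\<sigma> z) = g' (h0 \<bullet> z)" if z: "z \<in> ball z0 r" for z
  proof -
    have zS: "\<sigma> z \<in> S" using \<sigma>[OF z] U(2) by blast
    have "((\<lambda>z. g (h0 \<bullet> z)) has_derivative (\<lambda>k. (h0 \<bullet> k) *\<^sub>R g' (h0 \<bullet> z))) (at z)"
      by (rule has_derivative_compose[where f = "\<lambda>z. h0 \<bullet> z", OF _ dg[OF J[OF z]]])
        (auto intro!: derivative_eq_intros)
    then have "((\<lambda>z. f (\<sigma> z)) has_derivative (\<lambda>k. (h0 \<bullet> k) *\<^sub>R g' (h0 \<bullet> z))) (at z)"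
      by (rule has_derivative_transform_within_open[OF _ open_ball z]) (simp add: f\<sigma>)
    moreover have "((\<lambda>z. f (\<sigma> z)) has_derivative (\<lambda>k. fd f (\<sigma> z) (\<sigma>' z k))) (at z)"
      by (rule has_derivative_compose[where f = \<sigma>, OF _ smooth_onD(1)[OF sm(3) zS]]) (use \<sigma>[OF z] in simp)
    ultimately have "(\<lambda>k. (h0 \<bullet> k) *\<^sub>R g' (h0 \<bullet> z)) = (\<lambda>k. fd f (\<sigma> z) (\<sigma>' z k))"
      by (rule has_derivative_unique)
    from fun_cong[OF this, of h0] show ?thesis by (simp add: df[OF zS] t\<sigma>[OF z] h00)
  qed
  have x\<sigma>: "x (\<sigma> z) \<in> \<gamma> (h0 \<bullet> z)" if z: "z \<in> ball z0 r" for z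
  proof -
    define s where "s = h0 \<bullet> z"
    \<comment> \<open>Projecting away the fixed vectors \<open>g s\<close> and \<open>g' s\<close>
      leaves only the multiple of \<open>x\<close> in its derivative along the segment. By
      \<open>xind\<close> the projected vector never vanishes, so its direction is constant.\<close>
    obtain \<pi> :: "real^5 \<Rightarrow> real^5" where \<pi>: "bounded_linear \<pi>" "\<And>v. \<pi> v = 0 \<longleftrightarrow> v \<in> span {g s, g' s}"
      using kernel_pair by blast
    note lin = bounded_linear.linear[OF \<pi>(1)]
    define q where "q \<theta> = \<sigma> (z1 s + \<theta> *\<^sub>R (z - z1 s))" for \<theta>
    have qS: "q \<theta> \<in> S" "f (q \<theta>) = g s" "E (q \<theta>) = g' s" if \<theta>: "0 \<le> \<theta>" "\<theta> \<le> 1" for \<theta>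
      using \<sigma>[OF seg(1)[OF z s_def \<theta>]] U(2) f\<sigma>[OF seg(1)[OF z s_def \<theta>]] E\<sigma>[OF seg(1)[OF z s_def \<theta>]]
      by (auto simp: q_def seg(2)[OF z s_def \<theta>])
    have "\<exists>a. ((\<lambda>\<theta>. \<pi> (x (q \<theta>))) has_vector_derivative a *\<^sub>R \<pi> (x (q \<theta>))) (at \<theta>)"
      if \<theta>: "0 \<le> \<theta>" "\<theta> \<le> 1" for \<theta>
    proof -
      note sg = seg[OF z s_def \<theta>]
      define h where "h = \<sigma>' (z1 s + \<theta> *\<^sub>R (z - z1 s)) (z - z1 s)"
      have "h0 \<bullet> (z - z1 s) = 0" using z1(2)[OF sg(3)] by (simp add: inner_diff_right s_def)
      then have "fd t (q \<theta>) h = 0" using t\<sigma>[OF sg(1)] by (simp add: q_def h_def)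
      from dx[OF qS(1)[OF \<theta>] this] obtain a b b' where
        abc: "fd x (q \<theta>) h = a *\<^sub>R x (q \<theta>) + b *\<^sub>R f (q \<theta>) + b' *\<^sub>R E (q \<theta>)"
        unfolding in_span_triple by blast
      have "\<pi> (g s) = 0" "\<pi> (g' s) = 0" unfolding \<pi>(2) by (auto intro: span_base)
      then have "\<pi> (fd x (q \<theta>) h) = a *\<^sub>R \<pi> (x (q \<theta>))"
        unfolding abc qS(2,3)[OF \<theta>] by (simp add: linear_add[OF lin] linear_cmul[OF lin])
      moreover have "((\<lambda>\<theta>. x (q \<theta>)) has_vector_derivative fd x (q \<theta>) h) (at \<theta>)"
        using segd[OF sm(1) sg(1)] by (simp add: q_def h_def)
      ultimately show ?thesis using bounded_linear.has_vector_derivative[OF \<pi>(1)] by metis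
    qed
    then obtain a where a: "\<And>\<theta>. 0 \<le> \<theta> \<Longrightarrow> \<theta> \<le> 1 \<Longrightarrow>
        ((\<lambda>\<theta>. \<pi> (x (q \<theta>))) has_vector_derivative a \<theta> *\<^sub>R \<pi> (x (q \<theta>))) (at \<theta>)" by metis
    have "\<pi> (x (q 1)) \<in> span {\<pi> (x (q 0))}"
    proof (rule direction_constant[OF a])
      show "\<pi> (x (q \<theta>)) \<noteq> 0" if "0 \<le> \<theta>" "\<theta> \<le> 1" for \<theta>
        using xind[OF qS(1)[OF that]] qS(2,3)[OF that] \<pi>(2) by simp
    qed
    then obtain b where "\<pi> (x (q 1)) = b *\<^sub>R \<pi> (x (q 0))" unfolding in_span_sing by blast
    then have "\<pi> (x (q 1) - b *\<^sub>R x (q 0)) = 0" by (simp add: linear_diff[OF lin] linear_cmul[OF lin])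
    then obtain a1 a2 where "x (q 1) - b *\<^sub>R x (q 0) = a1 *\<^sub>R g s + a2 *\<^sub>R g' s"
      unfolding \<pi>(2) in_span_pair by blast
    then have "x (q 1) = a1 *\<^sub>R g s + a2 *\<^sub>R g' s + b *\<^sub>R x (q 0)" by (simp add: algebra_simps)
    then have "x (q 1) \<in> \<gamma> s" unfolding \<gamma>_def in_span_triple by (auto simp: y_def c_def q_def)
    then show ?thesis by (simp add: q_def s_def)
  qed
  have U1: "f p = g (t p)" "E p = g' (t p)" "x p \<in> \<gamma> (t p)" if p: "p \<in> U" for p
  proof -
    obtain z where z: "z \<in> ball z0 r" "\<sigma> z = p" using \<sigma>U[OF p] by blast
    then have "t p = h0 \<bullet> z" using \<sigma>[OF z(1)] by simp
    then show "f p = g (t p)" "E p = g' (t p)" "x p \<in> \<gamma> (t p)"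
      using f\<sigma>[OF z(1)] E\<sigma>[OF z(1)] x\<sigma>[OF z(1)] z(2) by simp_all
  qed

  \<comment> \<open>By exchange, any point over the fibre can replace the point on the transversal
    as third generator of the plane. This is used near an arbitrary line of the pencil.\<close>
  have \<gamma>x: "\<gamma> s = span {g s, g' s, x p}" if p: "p \<in> U" "t p = s" for p s
  proof -
    have sets: "{g s, g' s, w} = insert w {g s, g' s}" for w by auto
    have pS: "p \<in> S" using p(1) U(2) by blast
    have 1: "x p \<in> span (insert (y s) {g s, g' s})"
      using U1(3)[OF p(1)] unfolding p(2) \<gamma>_def sets .
    moreover have "x p \<notin> span {g s, g' s}" using xind[OF pS] unfolding U1(1,2)[OF p(1)] p(2) .
    ultimately have 2: "y s \<in> span (insert (x p) {g s, g' s})" by (rule in_span_insert)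
    show ?thesis
      unfolding \<gamma>_def sets span_eq using 1 2 by (simp add: span_base)
  qed
  have g0: "g s \<noteq> 0" and g'ind: "g' s \<notin> span {g s}" and yind: "y s \<notin> span {g s, g' s}"
    and eg: "e \<bullet> g s = 1" "e' \<bullet> g s = s" if s: "s \<in> J" for s
  proof -
    note cs = cU(2)[OF s]
    show eg: "e \<bullet> g s = 1" "e' \<bullet> g s = s"
      using e[OF cs] \<sigma>[OF z1(1)[OF s]] z1(2)[OF s] by (simp_all add: g_def c_def)
    then show "g s \<noteq> 0" by auto
    show "g' s \<notin> span {g s}" using E[OF cs] span_mono[of "{f (c s)}" "{x (c s), f (c s)}"]
      by (auto simp: g_def g'_def)
    show "y s \<notin> span {g s, g' s}" using xind[OF cs] by (simp add: g_def g'_def y_def)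
  qed
  have tan: "tangent_space g s = span {g s, g' s}" if s: "s \<in> J" for s
  proof -
    have "range (fd g s) = span {g' s}" using fd_eqI[OF dg[OF s]] by (auto simp: span_singleton)
    then have "tangent_space g s = span (insert (g s) (span {g' s}))" by (simp add: tangent_space_def)
    also have "\<dots> = span {g s, g' s}"
      unfolding span_eq using span_mono[of "{g' s}" "{g s, g' s}"] by (auto simp: span_base)
    finally show ?thesis .
  qed
  have dim\<gamma>: "dim (\<gamma> s) = 3" if s: "s \<in> J" for s
  proof -
    have "dim (span {y s, g s, g' s}) = dim {g s, g' s} + 1" using yind[OF s] by (simp add: dim_insert)
    then show ?thesis using dim_span_pair[OF g0[OF s] g'ind[OF s]]
      by (simp add: \<gamma>_def insert_commute)
  qed
  have genU: "generator \<Omega> x p = span {x p, g (t p)}" if "p \<in> U" for p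
    using gen[of p] U1(1)[OF that] U(2) that by auto

  have pencil: "open_part_of_pencil {generator \<Omega> x p | p. p \<in> U \<and> t p = s} (g s) (\<gamma> s)"
    if s: "s \<in> J" for s
  proof -
    define Ls where "Ls = {generator \<Omega> x p | p. p \<in> U \<and> t p = s}"
    have tc: "t (c s) = s" using \<sigma>[OF z1(1)[OF s]] z1(2)[OF s] by (simp add: c_def)
    then have "Ls \<noteq> {}" using cU(1)[OF s] unfolding Ls_def by blast
    moreover have "Ls \<subseteq> pencil (g s) (\<gamma> s)"
    proof
      fix L assume "L \<in> Ls"
      then obtain p where p: "p \<in> U" "t p = s" and L: "L = span {x p, g s}"
        using genU unfolding Ls_def by blast
      have "x p \<notin> span {g s}" using E[of p] U(2) U1(1)[OF p(1)] p by auto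
      from dim_span_pair[OF g0[OF s] this] have "dim L = 2"
        unfolding L insert_commute[of "x p" "g s" "{}"] .
      moreover have "L \<subseteq> \<gamma> s" unfolding L \<gamma>x[OF p] by (rule span_mono) auto
      ultimately show "L \<in> pencil (g s) (\<gamma> s)" by (simp add: pencil_def L span_base)
    qed
    moreover have "openin (top_of_set (\<gamma> s)) {v\<in>\<gamma> s. v \<notin> span {g s} \<and> span {g s, v} \<in> Ls}"
    proof (subst openin_subopen, rule ballI)
      fix v0 assume "v0 \<in> {v\<in>\<gamma> s. v \<notin> span {g s} \<and> span {g s, v} \<in> Ls}"
      then have v0: "v0 \<in> \<gamma> s" "v0 \<notin> span {g s}" "span {g s, v0} \<in> Ls" by auto
      then obtain p where p: "p \<in> U" "t p = s" and vp: "span {g s, v0} = span {x p, g s}"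
        using genU unfolding Ls_def by blast
      have pS: "p \<in> S" using p U(2) by blast
      have "v0 \<in> span {x p, g s}" unfolding vp[symmetric] by (simp add: span_base)
      then obtain l m where lm: "v0 = l *\<^sub>R x p + m *\<^sub>R g s" unfolding in_span_pair by blast
      have l: "l \<noteq> 0" using v0(2) lm by (auto simp: in_span_sing)
      obtain z where z: "z \<in> ball z0 r" "\<sigma> z = p" using \<sigma>U[OF p(1)] by blast
      have hz: "h0 \<bullet> z = s" using \<sigma>[OF z(1)] z(2) p(2) by simp
      \<comment> \<open>A direction tangent to the fibre along which the generator turns. Its
        preimage \<open>k\<close> in the chart is tangent to the slice, so the straight path from
        \<open>z\<close> along \<open>k\<close> remains over the same center and plane.\<close>
      obtain h where h: "fd t p h = 0" "fd x p h \<notin> span {x p, f p}" using tr[OF pS] by blast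
      obtain k where k: "\<sigma>' z k = h" using \<sigma>'surj[OF z(1)] by blast
      have hk: "h0 \<bullet> k = 0" using t\<sigma>[OF z(1), of k] h(1) k z(2) by simp
      define X where "X \<theta> = x (\<sigma> (z + \<theta> *\<^sub>R k))" for \<theta>
      have X0: "X 0 = x p" by (simp add: X_def z)
      obtain d where d: "d > 0" "ball z d \<subseteq> ball z0 r" using openE[OF open_ball z(1)] by blast
      define \<eta> where "\<eta> = d / (norm k + 1)"
      have nk: "norm k + 1 > 0" by (simp add: add_nonneg_pos)
      have \<eta>: "\<eta> > 0" using d nk by (simp add: \<eta>_def)
      have near: "z + \<theta> *\<^sub>R k \<in> ball z0 r" if "\<theta> \<in> {-\<eta>..\<eta>}" for \<theta>
      proof -
        have "\<bar>\<theta>\<bar> * norm k \<le> \<eta> * norm k" using that by (intro mult_right_mono) auto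
        also have "\<dots> < \<eta> * (norm k + 1)" using \<eta> by simp
        also have "\<dots> = d" using nk by (simp add: \<eta>_def)
        finally have "z + \<theta> *\<^sub>R k \<in> ball z d" by (simp add: dist_norm)
        then show ?thesis using d(2) by blast
      qed
      have XU: "\<sigma> (z + \<theta> *\<^sub>R k) \<in> U" "t (\<sigma> (z + \<theta> *\<^sub>R k)) = s" if "\<theta> \<in> {-\<eta>..\<eta>}" for \<theta>
        using \<sigma>[OF near[OF that]] by (simp_all add: inner_add_right hk hz)
      have dX: "(X has_vector_derivative fd x (\<sigma> (z + \<theta> *\<^sub>R k)) (\<sigma>' (z + \<theta> *\<^sub>R k) k)) (at \<theta>)"
        if "\<theta> \<in> {-\<eta>..\<eta>}" for \<theta>
        unfolding X_def by (rule segd[OF sm(1) near[OF that]])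
      have dX0: "(X has_vector_derivative fd x p h) (at 0)" using dX[of 0] \<eta> by (simp add: z k)
      have contX: "continuous_on {-\<eta>..\<eta>} X"
        by (intro continuous_at_imp_continuous_on ballI has_vector_derivative_continuous[OF dX])
      have Xin: "X \<theta> \<in> span {g s, g' s, X 0}" if "\<theta> \<in> {-\<eta>..\<eta>}" for \<theta>
        using U1(3)[OF XU(1)[OF that]] XU(2)[OF that] \<gamma>x[OF p] X0 by (simp add: X_def)
      have X1: "fd x p h \<in> span {g s, g' s, X 0}"
        using dx[OF pS h(1)] U1(1,2)[OF p(1)] p(2) X0 by (simp add: insert_commute)
      have X2: "fd x p h \<notin> span {X 0, g s}" using h(2) U1(1)[OF p(1)] p(2) X0 by simp
      have ind: "X 0 \<notin> span {g s, g' s}" "g' s \<notin> span {X 0, g s}"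
        using xind[OF pS] E[OF pS] U1(1,2)[OF p(1)] p(2) X0 by simp_all
      have v0eq: "v0 = m *\<^sub>R g s + l *\<^sub>R X 0" by (simp add: lm X0)
      obtain T where T: "open T" "v0 \<in> T"
        "\<And>v. v \<in> T \<Longrightarrow> v \<in> span {g s, g' s, X 0} \<Longrightarrow>
          v \<notin> span {g s} \<and> (\<exists>\<theta>\<in>{-\<eta>..\<eta>}. span {g s, v} = span {X \<theta>, g s})"
        by (rule lines_through_curve_open[OF dX0 \<eta> contX Xin X1 X2 ind v0eq l]) (assumption, rule that, assumption+)
      show "\<exists>T. openin (top_of_set (\<gamma> s)) T \<and> v0 \<in> T \<and>
          T \<subseteq> {v\<in>\<gamma> s. v \<notin> span {g s} \<and> span {g s, v} \<in> Ls}"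
      proof (intro exI conjI)
        show "openin (top_of_set (\<gamma> s)) (\<gamma> s \<inter> T)" using T(1) by (rule openin_open_Int)
        show "v0 \<in> \<gamma> s \<inter> T" using v0 T by simp
        show "\<gamma> s \<inter> T \<subseteq> {v\<in>\<gamma> s. v \<notin> span {g s} \<and> span {g s, v} \<in> Ls}"
        proof
          fix v assume v: "v \<in> \<gamma> s \<inter> T"
          then obtain \<theta> where \<theta>: "\<theta> \<in> {-\<eta>..\<eta>}" "span {g s, v} = span {X \<theta>, g s}" and "v \<notin> span {g s}"
            using T(3)[of v] \<gamma>x[OF p] X0 by auto
          moreover have "generator \<Omega> x (\<sigma> (z + \<theta> *\<^sub>R k)) = span {X \<theta>, g s}"
            using genU[OF XU(1)[OF \<theta>(1)]] XU(2)[OF \<theta>(1)] by (simp add: X_def)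
          then have "span {X \<theta>, g s} \<in> Ls" using XU[OF \<theta>(1)] unfolding Ls_def by blast
          ultimately show "v \<in> {v\<in>\<gamma> s. v \<notin> span {g s} \<and> span {g s, v} \<in> Ls}" using v by simp
        qed
      qed
    qed
    ultimately show ?thesis unfolding open_part_of_pencil_def Ls_def by blast
  qed

  show ?thesis
  proof (intro exI conjI ballI)
    show "open U" "p\<^sub>0 \<in> U" "U \<subseteq> \<Omega>" "open J" "is_interval J"
      using U S oJ by (auto simp: J_def is_interval_oo)
    show "smooth_on U t" by (rule smooth_on_subset[OF sm(2) U(2)])
    have "s \<in> t ` U" if "s \<in> J" for s
      using \<sigma>[OF z1(1)[OF that]] z1(2)[OF that] by (intro image_eqI[of _ _ "c s"]) (auto simp: c_def)
    then show "t ` U = J" using tJ by blast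
    show "fd t p \<noteq> (\<lambda>h. 0)" if "p \<in> U" for p
      using dt0[of p] U(2) that by (metis subset_iff)
    show "smooth_on J g" unfolding g_def[abs_def] by (rule curve[OF sm(3)])
    show "g s \<noteq> 0" if "s \<in> J" for s by (rule g0[OF that])
    show "proj_rank g s = 1" if "s \<in> J" for s
      unfolding proj_rank_def tan[OF that] dim_span_pair[OF g0[OF that] g'ind[OF that]] by simp
    show "inj_on (\<lambda>s. span {g s}) J"
    proof (rule inj_onI)
      fix s s' assume s: "s \<in> J" "s' \<in> J" and "span {g s} = span {g s'}"
      then have "g s \<in> span {g s'}" using span_base[of "g s" "{g s}"] by simp
      then obtain b where b: "g s = b *\<^sub>R g s'" unfolding in_span_sing by blast
      \<comment> \<open>The normalisation by \<open>e\<close> fixes the scale of \<open>g\<close>,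
        and then \<open>e'\<close> reads the parameter off the vector.\<close>
      have "e \<bullet> g s = b * (e \<bullet> g s')" by (simp only: b inner_scaleR_right)
      then have "b = 1" unfolding eg(1)[OF s(1)] eg(1)[OF s(2)] by simp
      then have "g s = g s'" using b by simp
      then have "e' \<bullet> g s = e' \<bullet> g s'" by (rule arg_cong)
      then show "s = s'" unfolding eg(2)[OF s(1)] eg(2)[OF s(2)] .
    qed
    show "span {F p} = span {g (t p)}" if "p \<in> U" for p
      using gen[of p] U(2) U1(1)[OF that] that by auto
    have "smooth_on J g" "smooth_on J g'" "smooth_on J y"
      using curve[OF sm(3)] curve[OF sm(4)] curve[OF sm(1)]
      by (simp_all add: g_def[abs_def] g'_def[abs_def] y_def[abs_def])
    moreover have "subspace (\<gamma> s)" for s by (simp add: \<gamma>_def)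
    ultimately show "smooth_plane_family J \<gamma>"
      unfolding smooth_plane_family_def using dim\<gamma> \<gamma>_def by blast
    show "tangent_space g s \<subseteq> \<gamma> s" if "s \<in> J" for s
      unfolding tan[OF that] \<gamma>_def by (rule span_mono) auto
    show "open_part_of_pencil {generator \<Omega> x p | p. p \<in> U \<and> t p = s} (g s) (\<gamma> s)" if "s \<in> J" for s
      by (rule pencil[OF that])
  qed
qed

end
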